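(* Let $\mathcal{U}$ and $\mathcal{V}$ be two $t$-structures on a triangulated category $\mathcal{T}$ satisfying $d(\mathcal{U},\mathcal{V})<+\infty$. Then the following statements hold. (1) $\bigcap_{n\in\mathbb{Z}}\mathcal{U}_{\leq n}=\bigcap_{n\in\mathbb{Z}}\mathcal{V}_{\leq n}$ and $\bigcap_{n\in\mathbb{Z}}\mathcal{U}_{\geq n}=\bigcap_{n\in\mathbb{Z}}\mathcal{V}_{\geq n}$. Therefore, $\mathcal{U}$ is non-degenerate if and only if so is $\mathcal{V}$. (2) $\mathcal{U}_{\mathbb{N}}=\mathcal{V}_{\mathbb{N}}$. Therefore, $\mathcal{U}$ is bounded if and only if so is $\mathcal{V}$. (3) The $t$-structure $\mathcal{U}$ is regular if and only if so is $\mathcal{V}$. (4) $\mathrm{gl.dim}(\mathcal{U})<+\infty$ if and only if $\mathrm{gl.dim}(\mathcal{V})<+\infty$. (5) Assume that either $\mathcal{U}$ or $\mathcal{V}$ is stable. Then $\mathcal{U}=\mathcal{V}$.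
   Context: Let $\Sigma$ denote the translation functor of a triangulated category. A $t$-structure $\mathcal{U}=(\mathcal{U}_{\leq 0},\mathcal{U}_{\geq 0})$ on a triangulated category $\mathcal{T}$ consists of two full subcategories (closed under isomorphisms) such that: (T1) $\Sigma\mathcal{U}_{\leq 0}\subseteq\mathcal{U}_{\leq 0}$ and $\Sigma^{-1}\mathcal{U}_{\geq 0}\subseteq\mathcal{U}_{\geq 0}$; (T2) $\mathrm{Hom}_{\mathcal{T}}(X,Y)=0$ for all $X\in\mathcal{U}_{\leq 0}$, $Y\in\Sigma^{-1}\mathcal{U}_{\geq 0}$; (T3) every $Z\in\mathcal{T}$ fits into an exact triangle $X\to Z\to \Sigma^{-1}(Y)\to\Sigma(X)$ with $X\in\mathcal{U}_{\leq 0}$, $Y\in\mathcal{U}_{\geq 0}$. For $n\in\mathbb{Z}$ put $\mathcal{U}_{\leq n}=\Sigma^{-n}\mathcal{U}_{\leq 0}$ and $\mathcal{U}_{\geq n}=\Sigma^{-n}\mathcal{U}_{\geq 0}$. For $m\leq n$ put $\mathcal{U}_{[m,n]}=\mathcal{U}_{\geq m}\cap\mathcal{U}_{\leq n}$, and put $\mathcal{U}_{\mathbb{N}}=\bigcup_{n\geq 0}\mathcal{U}_{[-n,n]}$. The same notation is used for $\mathcal{V}$. The distance $d(\mathcal{U},\mathcal{V})$ is the smallest natural number $d\geq 0$ such that $\mathcal{V}_{\leq m}\subseteq\mathcal{U}_{\leq 0}\subseteq\mathcal{V}_{\leq m+d}$ for some integer $m$; if no such $d$ exists, $d(\mathcal{U},\mathcal{V})=+\infty$.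 $\mathcal{U}$ is non-degenerate if $\bigcap_{n\in\mathbb{Z}}\mathcal{U}_{\leq n}=\{0\}=\bigcap_{n\in\mathbb{Z}}\mathcal{U}_{\geq n}$ (only zero objects). $\mathcal{U}$ is bounded if $\bigcup_{n\in\mathbb{Z}}\mathcal{U}_{\leq n}=\mathcal{T}=\bigcup_{n\in\mathbb{Z}}\mathcal{U}_{\geq n}$. $\mathcal{U}$ is stable if $\Sigma\mathcal{U}_{\leq 0}=\mathcal{U}_{\leq 0}$. The global dimension $\mathrm{gl.dim}(\mathcal{U})$ is the smallest natural number $d\geq 0$ such that $\mathrm{Hom}_{\mathcal{T}}(X,Y)=0$ for all $X\in\mathcal{U}_{\geq 0}$, $Y\in\mathcal{U}_{\leq -(d+1)}$, and is $+\infty$ if no such $d$ exists. Let $\tau_{\leq n}$ be the right adjoint of the inclusion $\mathcal{U}_{\leq n}\hookrightarrow\mathcal{T}$ and $\tau_{\geq n}$ the left adjoint of the inclusion $\mathcal{U}_{\geq n}\hookrightarrow\mathcal{T}$ (truncation functors). The $t$-structure $\mathcal{U}$ is regular if the canonical map $\mathrm{Hom}_{\mathcal{T}}(X,Y)\to\varprojlim_{n\to+\infty}\mathrm{Hom}_{\mathcal{T}}(\tau_{\leq n}(X),Y)$ is injective for every $X\in\mathcal{T}$ and every $Y\in\bigcup_{m\in\mathbb{Z}}\mathcal{U}_{\leq m}$, and the canonical map $\mathrm{Hom}_{\mathcal{T}}(X,Y)\to\varprojlim_{n\to+\infty}\mathrm{Hom}_{\mathcal{T}}(X,\tau_{\geq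 -n}(Y))$ is injective for every $Y\in\mathcal{T}$ and every $X\in\bigcup_{m\in\mathbb{Z}}\mathcal{U}_{\geq m}$. *)

theory Defs
  imports "HOL-Algebra.Group" "HOL-Library.Extended_Nat"
begin

section \<open>Categories, functors, adjunctions\<close>

record ('o, 'm) cat =
  Obj :: "'o set"
  Arr :: "'m set"
  Dom :: "'m \<Rightarrow> 'o"
  Cod :: "'m \<Rightarrow> 'o"
  Id  :: "'o \<Rightarrow> 'm"
  Comp :: "'m \<Rightarrow> 'm \<Rightarrow> 'm"  (infixr "\<cdot>\<index>" 70)

definition Hom :: "('o, 'm, 'x) cat_scheme \<Rightarrow> 'o \<Rightarrow> 'o \<Rightarrow> 'm set" where
  "Hom C X Y = {f \<in> Arr C. Dom C f = X \<and> Cod C f = Y}"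

locale category =
  fixes C :: "('o, 'm, 'x) cat_scheme" (structure)
  assumes dom_closed: "f \<in> Arr C \<Longrightarrow> Dom C f \<in> Obj C"
    and cod_closed: "f \<in> Arr C \<Longrightarrow> Cod C f \<in> Obj C"
    and id_closed: "X \<in> Obj C \<Longrightarrow> Id C X \<in> Hom C X X"
    and comp_closed: "\<lbrakk>f \<in> Hom C X Y; g \<in> Hom C Y Z\<rbrakk> \<Longrightarrow> g \<cdot> f \<in> Hom C X Z"
    and comp_assoc:
      "\<lbrakk>f \<in> Hom C W X; g \<in> Hom C X Y; h \<in> Hom C Y Z\<rbrakk> \<Longrightarrow> (h \<cdot> g) \<cdot> f = h \<cdot> (g \<cdot> f)"
    and id_left: "f \<in> Hom C X Y \<Longrightarrow> Id C Y \<cdot> f = f"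
    and id_right: "f \<in> Hom C X Y \<Longrightarrow> f \<cdot> Id C X = f"

definition iso_arr :: "('o, 'm, 'x) cat_scheme \<Rightarrow> 'm \<Rightarrow> bool" where
  "iso_arr C f \<longleftrightarrow> f \<in> Arr C \<and>
     (\<exists>g \<in> Hom C (Cod C f) (Dom C f).
        g \<cdot>\<^bsub>C\<^esub> f = Id C (Dom C f) \<and> f \<cdot>\<^bsub>C\<^esub> g = Id C (Cod C f))"

definition isomorphic :: "('o, 'm, 'x) cat_scheme \<Rightarrow> 'o \<Rightarrow> 'o \<Rightarrow> bool" where
  "isomorphic C X Y \<longleftrightarrow> (\<exists>f \<in> Hom C X Y. iso_arr C f)"

definition zero_obj :: "('o, 'm, 'x) cat_scheme \<Rightarrow> 'o \<Rightarrow> bool" where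
  "zero_obj C Z \<longleftrightarrow> Z \<in> Obj C \<and>
     (\<forall>X \<in> Obj C. (\<exists>!f. f \<in> Hom C X Z) \<and> (\<exists>!f. f \<in> Hom C Z X))"

definition full_sub :: "('o, 'm, 'x) cat_scheme \<Rightarrow> 'o set \<Rightarrow> ('o, 'm, 'x) cat_scheme" where
  "full_sub C S = C\<lparr>Obj := S, Arr := {f \<in> Arr C. Dom C f \<in> S \<and> Cod C f \<in> S}\<rparr>"

record ('o, 'm, 'p, 'n) functor_data =
  omap :: "'o \<Rightarrow> 'p"
  amap :: "'m \<Rightarrow> 'n"

definition is_functor ::
  "('o, 'm, 'x) cat_scheme \<Rightarrow> ('p, 'n, 'y) cat_scheme \<Rightarrow> ('o, 'm, 'p, 'n) functor_data \<Rightarrow> bool" where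
  "is_functor C D F \<longleftrightarrow>
     (\<forall>X \<in> Obj C. omap F X \<in> Obj D \<and> amap F (Id C X) = Id D (omap F X)) \<and>
     (\<forall>X Y. \<forall>f \<in> Hom C X Y. amap F f \<in> Hom D (omap F X) (omap F Y)) \<and>
     (\<forall>X Y Z. \<forall>f \<in> Hom C X Y. \<forall>g \<in> Hom C Y Z. amap F (g \<cdot>\<^bsub>C\<^esub> f) = amap F g \<cdot>\<^bsub>D\<^esub> amap F f)"

text \<open>Also used as the inclusion functor of a full subcategory.\<close>

definition id_functor :: "('o, 'm, 'o, 'm) functor_data" where
  "id_functor = \<lparr>omap = (\<lambda>X. X), amap = (\<lambda>f. f)\<rparr>"

definition comp_functor ::
  "('p, 'n, 'q, 'k) functor_data \<Rightarrow> ('o, 'm, 'p, 'n) functor_data \<Rightarrow> ('o, 'm, 'q, 'k) functor_data" where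
  "comp_functor G F = \<lparr>omap = omap G \<circ> omap F, amap = amap G \<circ> amap F\<rparr>"

definition nat_trans ::
  "('o, 'm, 'x) cat_scheme \<Rightarrow> ('p, 'n, 'y) cat_scheme \<Rightarrow> ('o, 'm, 'p, 'n) functor_data \<Rightarrow>
   ('o, 'm, 'p, 'n) functor_data \<Rightarrow> ('o \<Rightarrow> 'n) \<Rightarrow> bool" where
  "nat_trans C D F G t \<longleftrightarrow>
     (\<forall>X \<in> Obj C. t X \<in> Hom D (omap F X) (omap G X)) \<and>
     (\<forall>X Y. \<forall>f \<in> Hom C X Y. t Y \<cdot>\<^bsub>D\<^esub> amap F f = amap G f \<cdot>\<^bsub>D\<^esub> t X)"

definition nat_iso ::
  "('o, 'm, 'x) cat_scheme \<Rightarrow> ('p, 'n, 'y) cat_scheme \<Rightarrow> ('o, 'm, 'p, 'n) functor_data \<Rightarrow>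
   ('o, 'm, 'p, 'n) functor_data \<Rightarrow> ('o \<Rightarrow> 'n) \<Rightarrow> bool" where
  "nat_iso C D F G t \<longleftrightarrow> nat_trans C D F G t \<and> (\<forall>X \<in> Obj C. iso_arr D (t X))"

text \<open>\<open>L : C \<rightarrow> D\<close> is left adjoint to \<open>R : D \<rightarrow> C\<close>, with unit \<open>\<eta>\<close> and counit \<open>\<epsilon>\<close>.\<close>

definition adjunction ::
  "('o, 'm, 'x) cat_scheme \<Rightarrow> ('p, 'n, 'y) cat_scheme \<Rightarrow> ('o, 'm, 'p, 'n) functor_data \<Rightarrow>
   ('p, 'n, 'o, 'm) functor_data \<Rightarrow> ('o \<Rightarrow> 'm) \<Rightarrow> ('p \<Rightarrow> 'n) \<Rightarrow> bool" where
  "adjunction C D L R \<eta> \<epsilon> \<longleftrightarrow>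
     is_functor C D L \<and> is_functor D C R \<and>
     nat_trans C C id_functor (comp_functor R L) \<eta> \<and>
     nat_trans D D (comp_functor L R) id_functor \<epsilon> \<and>
     (\<forall>X \<in> Obj C. \<epsilon> (omap L X) \<cdot>\<^bsub>D\<^esub> amap L (\<eta> X) = Id D (omap L X)) \<and>
     (\<forall>Y \<in> Obj D. amap R (\<epsilon> Y) \<cdot>\<^bsub>C\<^esub> \<eta> (omap R Y) = Id C (omap R Y))"


section \<open>Additive and triangulated categories\<close>

record ('o, 'm) preadd_cat = "('o, 'm) cat" +
  Add :: "'m \<Rightarrow> 'm \<Rightarrow> 'm"  (infixl "\<boxplus>\<index>" 65)
  Zero :: "'o \<Rightarrow> 'o \<Rightarrow> 'm"

definition hom_group :: "('o, 'm, 'x) preadd_cat_scheme \<Rightarrow> 'o \<Rightarrow> 'o \<Rightarrow> 'm monoid" where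
  "hom_group C X Y = \<lparr>carrier = Hom C X Y, mult = Add C, one = Zero C X Y\<rparr>"

definition Neg :: "('o, 'm, 'x) preadd_cat_scheme \<Rightarrow> 'm \<Rightarrow> 'm" where
  "Neg C f = inv\<^bsub>hom_group C (Dom C f) (Cod C f)\<^esub> f"

locale additive_category = category C
  for C :: "('o, 'm, 'x) preadd_cat_scheme" (structure) +
  assumes hom_comm_group:
      "\<lbrakk>X \<in> Obj C; Y \<in> Obj C\<rbrakk> \<Longrightarrow> comm_group (hom_group C X Y)"
    and comp_add_left:
      "\<lbrakk>f \<in> Hom C X Y; g \<in> Hom C Y Z; g' \<in> Hom C Y Z\<rbrakk>
        \<Longrightarrow> (g \<boxplus> g') \<cdot> f = (g \<cdot> f) \<boxplus> (g' \<cdot> f)"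
    and comp_add_right:
      "\<lbrakk>f \<in> Hom C X Y; f' \<in> Hom C X Y; g \<in> Hom C Y Z\<rbrakk>
        \<Longrightarrow> g \<cdot> (f \<boxplus> f') = (g \<cdot> f) \<boxplus> (g \<cdot> f')"
    and ex_zero_obj: "\<exists>Z. zero_obj C Z"
    and ex_biproduct:
      "\<lbrakk>X \<in> Obj C; Y \<in> Obj C\<rbrakk> \<Longrightarrow>
        \<exists>P \<in> Obj C. \<exists>i \<in> Hom C X P. \<exists>j \<in> Hom C Y P. \<exists>p \<in> Hom C P X. \<exists>q \<in> Hom C P Y.
          p \<cdot> i = Id C X \<and> q \<cdot> j = Id C Y \<and> p \<cdot> j = Zero C Y X \<and> q \<cdot> i = Zero C X Y \<and>
          (i \<cdot> p) \<boxplus> (j \<cdot> q) = Id C P"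

text \<open>The translation functor is an additive auto-equivalence with a chosen quasi-inverse
  (a strict automorphism being a special case). A triangle
  \<open>X \<rightarrow> Y \<rightarrow> Z \<rightarrow> \<Sigma>X\<close> is given by its three arrows.\<close>

record ('o, 'm) tri_cat = "('o, 'm) preadd_cat" +
  Sig :: "('o, 'm, 'o, 'm) functor_data"
  Sig_inv :: "('o, 'm, 'o, 'm) functor_data"
  Exact :: "('m \<times> 'm \<times> 'm) set"

definition triangle :: "('o, 'm, 'x) tri_cat_scheme \<Rightarrow> 'm \<Rightarrow> 'm \<Rightarrow> 'm \<Rightarrow> bool" where
  "triangle T f g h \<longleftrightarrow> (\<exists>X Y Z. f \<in> Hom T X Y \<and> g \<in> Hom T Y Z \<and> h \<in> Hom T Z (omap (Sig T) X))"

locale triangulated_category = additive_category T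
  for T :: "('o, 'm, 'x) tri_cat_scheme" (structure) +
  assumes sig_functor: "is_functor T T (Sig T)"
    and sig_inv_functor: "is_functor T T (Sig_inv T)"
    and sig_add: "\<lbrakk>f \<in> Hom T X Y; g \<in> Hom T X Y\<rbrakk>
        \<Longrightarrow> amap (Sig T) (f \<boxplus> g) = amap (Sig T) f \<boxplus> amap (Sig T) g"
    and sig_inv_sig: "\<exists>t. nat_iso T T (comp_functor (Sig_inv T) (Sig T)) id_functor t"
    and sig_sig_inv: "\<exists>t. nat_iso T T (comp_functor (Sig T) (Sig_inv T)) id_functor t"
    and exact_triangle: "(f, g, h) \<in> Exact T \<Longrightarrow> triangle T f g h"
    and TR1_id: "\<lbrakk>X \<in> Obj T; zero_obj T Z\<rbrakk>
        \<Longrightarrow> (Id T X, Zero T X Z, Zero T Z (omap (Sig T) X)) \<in> Exact T"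
    and TR1_iso:
      "\<lbrakk>(f, g, h) \<in> Exact T; triangle T f' g' h';
        u \<in> Hom T (Dom T f) (Dom T f'); v \<in> Hom T (Dom T g) (Dom T g');
        w \<in> Hom T (Dom T h) (Dom T h');
        iso_arr T u; iso_arr T v; iso_arr T w;
        v \<cdot> f = f' \<cdot> u; w \<cdot> g = g' \<cdot> v; amap (Sig T) u \<cdot> h = h' \<cdot> w\<rbrakk>
        \<Longrightarrow> (f', g', h') \<in> Exact T"
    and TR1_cone: "f \<in> Arr T \<Longrightarrow> \<exists>g h. (f, g, h) \<in> Exact T"
    and TR2: "triangle T f g h
        \<Longrightarrow> (f, g, h) \<in> Exact T \<longleftrightarrow> (g, h, Neg T (amap (Sig T) f)) \<in> Exact T"
    and TR3:
      "\<lbrakk>(f, g, h) \<in> Exact T; (f', g', h') \<in> Exact T;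
        u \<in> Hom T (Dom T f) (Dom T f'); v \<in> Hom T (Dom T g) (Dom T g'); v \<cdot> f = f' \<cdot> u\<rbrakk>
        \<Longrightarrow> \<exists>w \<in> Hom T (Dom T h) (Dom T h'). w \<cdot> g = g' \<cdot> v \<and> amap (Sig T) u \<cdot> h = h' \<cdot> w"
    and TR4:
      "\<lbrakk>f \<in> Hom T X Y; g \<in> Hom T Y Z;
        (f, a, a') \<in> Exact T; (g, b, b') \<in> Exact T; (g \<cdot> f, c, c') \<in> Exact T\<rbrakk>
        \<Longrightarrow> \<exists>u \<in> Hom T (Cod T a) (Cod T c). \<exists>v \<in> Hom T (Cod T c) (Cod T b).
              u \<cdot> a = c \<cdot> g \<and> c' \<cdot> u = a' \<and> v \<cdot> c = b \<and> b' \<cdot> v = amap (Sig T) f \<cdot> c' \<and>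
              (u, v, amap (Sig T) a \<cdot> b') \<in> Exact T"


section \<open>t-structures\<close>

definition Sig_pow :: "('o, 'm, 'x) tri_cat_scheme \<Rightarrow> int \<Rightarrow> 'o \<Rightarrow> 'o" where
  "Sig_pow T n = (if n \<ge> 0 then omap (Sig T) ^^ nat n else omap (Sig_inv T) ^^ nat (- n))"

text \<open>The full subcategory \<open>\<Sigma>\<^sup>n S\<close>, as an essential image.\<close>

definition shift :: "('o, 'm, 'x) tri_cat_scheme \<Rightarrow> int \<Rightarrow> 'o set \<Rightarrow> 'o set" where
  "shift T n S = {X \<in> Obj T. \<exists>A \<in> S. isomorphic T (Sig_pow T n A) X}"

text \<open>A pair \<open>U\<close> of sets of objects stands for the pair of full subcategories
  \<open>(U\<^sub>\<le>\<^sub>0, U\<^sub>\<ge>\<^sub>0)\<close>.\<close>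

definition t_le :: "('o, 'm, 'x) tri_cat_scheme \<Rightarrow> 'o set \<times> 'o set \<Rightarrow> int \<Rightarrow> 'o set" where
  "t_le T U n = shift T (- n) (fst U)"

definition t_ge :: "('o, 'm, 'x) tri_cat_scheme \<Rightarrow> 'o set \<times> 'o set \<Rightarrow> int \<Rightarrow> 'o set" where
  "t_ge T U n = shift T (- n) (snd U)"

definition iso_closed :: "('o, 'm, 'x) cat_scheme \<Rightarrow> 'o set \<Rightarrow> bool" where
  "iso_closed C S \<longleftrightarrow> S \<subseteq> Obj C \<and> (\<forall>X \<in> S. \<forall>Y \<in> Obj C. isomorphic C X Y \<longrightarrow> Y \<in> S)"

definition t_structure :: "('o, 'm, 'x) tri_cat_scheme \<Rightarrow> 'o set \<times> 'o set \<Rightarrow> bool" where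
  "t_structure T U \<longleftrightarrow>
     iso_closed T (fst U) \<and> iso_closed T (snd U) \<and>
     shift T 1 (fst U) \<subseteq> fst U \<and> shift T (- 1) (snd U) \<subseteq> snd U \<and>
     (\<forall>X \<in> fst U. \<forall>Y \<in> shift T (- 1) (snd U). Hom T X Y = {Zero T X Y}) \<and>
     (\<forall>Z \<in> Obj T. \<exists>X \<in> fst U. \<exists>Y \<in> snd U.
        \<exists>f \<in> Hom T X Z. \<exists>g \<in> Hom T Z (omap (Sig_inv T) Y).
        \<exists>h \<in> Hom T (omap (Sig_inv T) Y) (omap (Sig T) X). (f, g, h) \<in> Exact T)"

definition t_interval ::
  "('o, 'm, 'x) tri_cat_scheme \<Rightarrow> 'o set \<times> 'o set \<Rightarrow> int \<Rightarrow> int \<Rightarrow> 'o set" where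
  "t_interval T U m n = t_ge T U m \<inter> t_le T U n"

definition t_bdd_objs :: "('o, 'm, 'x) tri_cat_scheme \<Rightarrow> 'o set \<times> 'o set \<Rightarrow> 'o set" where
  "t_bdd_objs T U = (\<Union>n::nat. t_interval T U (- int n) (int n))"

text \<open>In \<open>enat\<close> the infimum of a nonempty set is its least element, and that of the empty set
  is \<open>\<infinity>\<close>.\<close>

definition t_dist ::
  "('o, 'm, 'x) tri_cat_scheme \<Rightarrow> 'o set \<times> 'o set \<Rightarrow> 'o set \<times> 'o set \<Rightarrow> enat" where
  "t_dist T U V =
     (INF d \<in> {d::nat. \<exists>m::int. t_le T V m \<subseteq> t_le T U 0 \<and> t_le T U 0 \<subseteq> t_le T V (m + int d)}. enat d)"

definition gl_dim :: "('o, 'm, 'x) tri_cat_scheme \<Rightarrow> 'o set \<times> 'o set \<Rightarrow> enat" where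
  "gl_dim T U =
     (INF d \<in> {d::nat. \<forall>X \<in> t_ge T U 0. \<forall>Y \<in> t_le T U (- (int d + 1)).
        Hom T X Y = {Zero T X Y}}. enat d)"

definition nondegenerate :: "('o, 'm, 'x) tri_cat_scheme \<Rightarrow> 'o set \<times> 'o set \<Rightarrow> bool" where
  "nondegenerate T U \<longleftrightarrow>
     (\<Inter>n. t_le T U n) = {X. zero_obj T X} \<and> (\<Inter>n. t_ge T U n) = {X. zero_obj T X}"

definition t_bounded :: "('o, 'm, 'x) tri_cat_scheme \<Rightarrow> 'o set \<times> 'o set \<Rightarrow> bool" where
  "t_bounded T U \<longleftrightarrow> (\<Union>n. t_le T U n) = Obj T \<and> (\<Union>n. t_ge T U n) = Obj T"

definition t_stable :: "('o, 'm, 'x) tri_cat_scheme \<Rightarrow> 'o set \<times> 'o set \<Rightarrow> bool" where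
  "t_stable T U \<longleftrightarrow> shift T 1 (fst U) = fst U"


subsection \<open>Truncation and regularity\<close>

text \<open>The right adjoint of the inclusion of \<open>U\<^sub>\<le>\<^sub>n\<close> together with its counit, and the left adjoint
  of the inclusion of \<open>U\<^sub>\<ge>\<^sub>n\<close> together with its unit. Both are unique up to unique isomorphism.\<close>

definition trunc_le :: "('o, 'm, 'x) tri_cat_scheme \<Rightarrow> 'o set \<times> 'o set \<Rightarrow> int \<Rightarrow>
    ('o, 'm, 'o, 'm) functor_data \<times> ('o \<Rightarrow> 'm)" where
  "trunc_le T U n =
     (SOME (R, \<epsilon>). \<exists>\<eta>. adjunction (full_sub T (t_le T U n)) T id_functor R \<eta> \<epsilon>)"

definition trunc_ge :: "('o, 'm, 'x) tri_cat_scheme \<Rightarrow> 'o set \<times> 'o set \<Rightarrow> int \<Rightarrow>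
    ('o, 'm, 'o, 'm) functor_data \<times> ('o \<Rightarrow> 'm)" where
  "trunc_ge T U n =
     (SOME (L, \<eta>). \<exists>\<epsilon>. adjunction T (full_sub T (t_ge T U n)) L id_functor \<eta> \<epsilon>)"

definition tau_le :: "('o, 'm, 'x) tri_cat_scheme \<Rightarrow> 'o set \<times> 'o set \<Rightarrow> int \<Rightarrow> 'o \<Rightarrow> 'o" where
  "tau_le T U n = omap (fst (trunc_le T U n))"

definition counit_le :: "('o, 'm, 'x) tri_cat_scheme \<Rightarrow> 'o set \<times> 'o set \<Rightarrow> int \<Rightarrow> 'o \<Rightarrow> 'm" where
  "counit_le T U n = snd (trunc_le T U n)"

definition tau_ge :: "('o, 'm, 'x) tri_cat_scheme \<Rightarrow> 'o set \<times> 'o set \<Rightarrow> int \<Rightarrow> 'o \<Rightarrow> 'o" where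
  "tau_ge T U n = omap (fst (trunc_ge T U n))"

definition unit_ge :: "('o, 'm, 'x) tri_cat_scheme \<Rightarrow> 'o set \<times> 'o set \<Rightarrow> int \<Rightarrow> 'o \<Rightarrow> 'm" where
  "unit_ge T U n = snd (trunc_ge T U n)"

text \<open>For \<open>m \<le> n\<close>, the canonical arrows \<open>\<tau>\<^sub>\<le>\<^sub>m X \<rightarrow> \<tau>\<^sub>\<le>\<^sub>n X\<close> over \<open>X\<close> and
  \<open>\<tau>\<^sub>\<ge>\<^sub>m Y \<rightarrow> \<tau>\<^sub>\<ge>\<^sub>n Y\<close> under \<open>Y\<close>.\<close>

definition trans_le ::
  "('o, 'm, 'x) tri_cat_scheme \<Rightarrow> 'o set \<times> 'o set \<Rightarrow> int \<Rightarrow> int \<Rightarrow> 'o \<Rightarrow> 'm" where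
  "trans_le T U m n X =
     (THE t. t \<in> Hom T (tau_le T U m X) (tau_le T U n X) \<and>
             counit_le T U n X \<cdot>\<^bsub>T\<^esub> t = counit_le T U m X)"

definition trans_ge ::
  "('o, 'm, 'x) tri_cat_scheme \<Rightarrow> 'o set \<times> 'o set \<Rightarrow> int \<Rightarrow> int \<Rightarrow> 'o \<Rightarrow> 'm" where
  "trans_ge T U m n Y =
     (THE t. t \<in> Hom T (tau_ge T U m Y) (tau_ge T U n Y) \<and>
             t \<cdot>\<^bsub>T\<^esub> unit_ge T U m Y = unit_ge T U n Y)"

text \<open>Inverse limits of sets indexed by the integers (ordered towards \<open>+\<infinity>\<close>), as sets of
  compatible families; \<open>r m n\<close> is the transition map \<open>A n \<rightarrow> A m\<close> for \<open>m \<le> n\<close>.\<close>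

definition inv_lim :: "(int \<Rightarrow> 'a set) \<Rightarrow> (int \<Rightarrow> int \<Rightarrow> 'a \<Rightarrow> 'a) \<Rightarrow> (int \<Rightarrow> 'a) set" where
  "inv_lim A r = {\<phi>. (\<forall>n. \<phi> n \<in> A n) \<and> (\<forall>m n. m \<le> n \<longrightarrow> r m n (\<phi> n) = \<phi> m)}"

definition lim_le ::
  "('o, 'm, 'x) tri_cat_scheme \<Rightarrow> 'o set \<times> 'o set \<Rightarrow> 'o \<Rightarrow> 'o \<Rightarrow> (int \<Rightarrow> 'm) set" where
  "lim_le T U X Y =
     inv_lim (\<lambda>n. Hom T (tau_le T U n X) Y) (\<lambda>m n \<phi>. \<phi> \<cdot>\<^bsub>T\<^esub> trans_le T U m n X)"

definition lim_ge ::
  "('o, 'm, 'x) tri_cat_scheme \<Rightarrow> 'o set \<times> 'o set \<Rightarrow> 'o \<Rightarrow> 'o \<Rightarrow> (int \<Rightarrow> 'm) set" where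
  "lim_ge T U X Y =
     inv_lim (\<lambda>n. Hom T X (tau_ge T U (- n) Y)) (\<lambda>m n \<phi>. trans_ge T U (- n) (- m) Y \<cdot>\<^bsub>T\<^esub> \<phi>)"

definition injective_map :: "('a \<Rightarrow> 'b) \<Rightarrow> 'a set \<Rightarrow> 'b set \<Rightarrow> bool" where
  "injective_map f A B \<longleftrightarrow> f ` A \<subseteq> B \<and> inj_on f A"

definition t_regular :: "('o, 'm, 'x) tri_cat_scheme \<Rightarrow> 'o set \<times> 'o set \<Rightarrow> bool" where
  "t_regular T U \<longleftrightarrow>
     (\<forall>X \<in> Obj T. \<forall>Y \<in> (\<Union>m. t_le T U m).
        injective_map (\<lambda>f n. f \<cdot>\<^bsub>T\<^esub> counit_le T U n X) (Hom T X Y) (lim_le T U X Y)) \<and>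
     (\<forall>Y \<in> Obj T. \<forall>X \<in> (\<Union>m. t_ge T U m).
        injective_map (\<lambda>f n. unit_ge T U (- n) Y \<cdot>\<^bsub>T\<^esub> f) (Hom T X Y) (lim_ge T U X Y))"

end

theory Submission
  imports Defs
begin

text \<open>
  The whole proposition reduces to one symmetric relation. If the distance is finite, then for some
  \<open>k\<close> the inclusions \<open>U\<^sub>\<le>\<^sub>n \<subseteq> V\<^sub>\<le>\<^sub>n\<^sub>+\<^sub>k\<close> and \<open>U\<^sub>\<ge>\<^sub>n \<subseteq> V\<^sub>\<ge>\<^sub>n\<^sub>-\<^sub>k\<close> hold in every degree \<open>n\<close>, and likewise with
  \<open>U\<close> and \<open>V\<close> exchanged (lemma \<open>near_if_finite_distance\<close>). The inclusions of the left halves come from the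
  definition of the distance by translation. Those of the right halves follow by taking right
  orthogonals, since \<open>U\<^sub>\<ge>\<^sub>n\<^sub>+\<^sub>1\<close> consists of all objects that receive no nonzero map from \<open>U\<^sub>\<le>\<^sub>n\<close>
  (lemma \<open>t_ge_if_orthogonal\<close>).

  Given \<open>k\<close>, the intersections and the unions over all degrees, and the bounded objects, are visibly the
  same for \<open>U\<close> and \<open>V\<close>; the global dimension changes by at most \<open>2k\<close>; and if \<open>U\<close> is stable, the
  chain \<open>U\<^sub>\<le>\<^sub>n\<close> is constant, so it is squeezed onto \<open>V\<^sub>\<le>\<^sub>0\<close>, and the right halves agree as orthogonals.

  Regularity seems to depend on the truncation functors, but it does not. A map into \<open>X\<close> from an object of
  \<open>U\<^sub>\<le>\<^sub>n\<close> factors through \<open>\<tau>\<^sub>\<le>\<^sub>n X \<rightarrow> X\<close>. Hence two maps out of \<open>X\<close> have the same image in the inverse limit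
  exactly when they agree on all maps into \<open>X\<close> from objects of the union of the \<open>U\<^sub>\<le>\<^sub>n\<close>. So regularity
  is a property of the two unions alone (lemma \<open>t_regular_iff\<close>), and these are shared by \<open>U\<close> and \<open>V\<close>.
  The argument uses the coreflection of each object into \<open>U\<^sub>\<le>\<^sub>n\<close>, which comes from a truncation triangle
  and the exactness of Hom functors, together with the translation of such triangles to every degree
  (lemma \<open>t_triangle\<close>). Reflections into \<open>U\<^sub>\<ge>\<^sub>n\<close> are treated as coreflections in the
  opposite category.\<close>

section \<open>Opposite categories and coreflections\<close>

text \<open>Reflections are handled as coreflections in the opposite category, so that the passage from universal
  arrows to adjoints and to limits is made only once.\<close>

definition op_cat :: "('o, 'm, 'x) cat_scheme \<Rightarrow> ('o, 'm, 'x) cat_scheme" where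
  "op_cat C = C\<lparr>Dom := Cod C, Cod := Dom C, Comp := (\<lambda>g f. f \<cdot>\<^bsub>C\<^esub> g)\<rparr>"

lemma op_cat_simps [simp]:
  "Obj (op_cat C) = Obj C" "Arr (op_cat C) = Arr C" "Id (op_cat C) = Id C"
  "Hom (op_cat C) X Y = Hom C Y X" "Comp (op_cat C) g f = f \<cdot>\<^bsub>C\<^esub> g"
  by (auto simp: op_cat_def Hom_def)

lemma op_cat_full_sub: "full_sub (op_cat C) S = op_cat (full_sub C S)"
  by (auto simp: op_cat_def full_sub_def conj_commute)

lemma Hom_full_sub: "Hom (full_sub C S) X Y = (if X \<in> S \<and> Y \<in> S then Hom C X Y else {})"
  by (auto simp: full_sub_def Hom_def)

lemma full_sub_simps [simp]:
  "Obj (full_sub C S) = S" "Id (full_sub C S) = Id C" "Comp (full_sub C S) = Comp C"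
  by (auto simp: full_sub_def)

lemma id_functor_simps [simp]: "omap id_functor X = X" "amap id_functor f = f"
  by (auto simp: id_functor_def)

lemma comp_functor_simps [simp]:
  "omap (comp_functor G F) X = omap G (omap F X)" "amap (comp_functor G F) f = amap G (amap F f)"
  by (auto simp: comp_functor_def)

lemma is_functor_op: "is_functor (op_cat C) (op_cat D) F \<longleftrightarrow> is_functor C D F"
  unfolding is_functor_def op_cat_simps by blast

lemma nat_trans_op: "nat_trans (op_cat C) (op_cat D) F G t \<longleftrightarrow> nat_trans C D G F t"
  unfolding nat_trans_def op_cat_simps by (metis (no_types))

lemma adjunction_op:
  "adjunction (op_cat D) (op_cat C) R L \<epsilon> \<eta> \<longleftrightarrow> adjunction C D L R \<eta> \<epsilon>"
  unfolding adjunction_def is_functor_op nat_trans_op op_cat_simps by blast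

lemma (in category) category_op: "category (op_cat C)"
proof
  fix f W X Y Z g h
  show "f \<in> Arr (op_cat C) \<Longrightarrow> Dom (op_cat C) f \<in> Obj (op_cat C)"
    "f \<in> Arr (op_cat C) \<Longrightarrow> Cod (op_cat C) f \<in> Obj (op_cat C)"
    using dom_closed cod_closed by (auto simp: op_cat_def)
qed (auto intro: id_closed comp_closed comp_assoc[symmetric] id_left id_right)

definition coreflection_arr :: "('o, 'm, 'x) cat_scheme \<Rightarrow> 'o set \<Rightarrow> 'o \<Rightarrow> 'o \<Rightarrow> 'm \<Rightarrow> bool" where
  "coreflection_arr C S X A e \<longleftrightarrow> A \<in> S \<and> e \<in> Hom C A X \<and>
     (\<forall>B\<in>S. \<forall>b\<in>Hom C B X. \<exists>!c. c \<in> Hom C B A \<and> e \<cdot>\<^bsub>C\<^esub> c = b)"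

definition coreflective :: "('o, 'm, 'x) cat_scheme \<Rightarrow> 'o set \<Rightarrow> bool" where
  "coreflective C S \<longleftrightarrow> S \<subseteq> Obj C \<and> (\<forall>X\<in>Obj C. \<exists>A e. coreflection_arr C S X A e)"

context category
begin

lemma HomD: "f \<in> Hom C X Y \<Longrightarrow> X \<in> Obj C" "f \<in> Hom C X Y \<Longrightarrow> Y \<in> Obj C"
  using dom_closed cod_closed by (auto simp: Hom_def)

text \<open>A right adjoint of the inclusion is assembled from chosen coreflections by the uniqueness in their
  universal property, which gives functoriality, naturality and both triangle identities.\<close>

lemma coreflective_adjunction:
  assumes "coreflective C S"
  shows "\<exists>R \<epsilon> \<eta>. adjunction (full_sub C S) C id_functor R \<eta> \<epsilon>"
proof -
  have S: "S \<subseteq> Obj C" using assms by (auto simp: coreflective_def)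
  obtain A e where Ae: "\<And>X. X \<in> Obj C \<Longrightarrow> coreflection_arr C S X (A X) (e X)"
    using assms unfolding coreflective_def by metis
  have A: "A X \<in> S" and e: "e X \<in> Hom C (A X) X" if "X \<in> Obj C" for X
    using Ae[OF that] by (auto simp: coreflection_arr_def)
  define fac where "fac B X b = (THE c. c \<in> Hom C B (A X) \<and> e X \<cdot> c = b)" for B X b
  have ex1: "\<exists>!c. c \<in> Hom C B (A X) \<and> e X \<cdot> c = b" if "B \<in> S" "b \<in> Hom C B X" for B X b
    using Ae[OF HomD(2)[OF that(2)]] that unfolding coreflection_arr_def by blast
  have fac: "fac B X b \<in> Hom C B (A X)" "e X \<cdot> fac B X b = b" if "B \<in> S" "b \<in> Hom C B X" for B X b
    using theI'[OF ex1[OF that]] unfolding fac_def by auto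
  have uniq: "c = c'"
    if "B \<in> S" "c \<in> Hom C B (A X)" "c' \<in> Hom C B (A X)" "e X \<cdot> c = e X \<cdot> c'" "X \<in> Obj C" for B X c c'
    using ex1[OF that(1) comp_closed[OF that(2) e[OF that(5)]]] that by metis
  define R :: "('o, 'm, 'o, 'm) functor_data" where
    "R = \<lparr>omap = A, amap = \<lambda>f. fac (A (Dom C f)) (Cod C f) (f \<cdot> e (Dom C f))\<rparr>"
  have RO: "omap R X = A X" for X by (simp add: R_def)
  have RA: "amap R f \<in> Hom C (A X) (A Y)" "e Y \<cdot> amap R f = f \<cdot> e X" if f: "f \<in> Hom C X Y" for f X Y
  proof -
    have "f \<cdot> e X \<in> Hom C (A X) Y" using e HomD(1)[OF f] comp_closed f by blast
    moreover have "amap R f = fac (A X) Y (f \<cdot> e X)" using f by (auto simp: R_def Hom_def)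
    ultimately show "amap R f \<in> Hom C (A X) (A Y)" "e Y \<cdot> amap R f = f \<cdot> e X"
      using fac[of "A X" "f \<cdot> e X" Y] A[OF HomD(1)[OF f]] by auto
  qed
  define \<eta> where "\<eta> Y = fac Y Y (Id C Y)" for Y
  have eta: "\<eta> Y \<in> Hom C Y (A Y)" "e Y \<cdot> \<eta> Y = Id C Y" if "Y \<in> S" for Y
    using fac[OF that id_closed] that S by (auto simp: \<eta>_def)
  have Rid: "amap R (Id C X) = Id C (A X)" if "X \<in> Obj C" for X
    using uniq[OF A[OF that] RA(1)[OF id_closed[OF that]] id_closed _ that] A e id_left id_right
      RA(2)[OF id_closed[OF that]] S that by (metis subsetD)
  have Rcomp: "amap R (g \<cdot> f) = amap R g \<cdot> amap R f"
    if f: "f \<in> Hom C X Y" and g: "g \<in> Hom C Y Z" for f g X Y Z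
  proof (rule uniq[of "A X" _ Z])
    have X: "X \<in> Obj C" and Y: "Y \<in> Obj C" and Z: "Z \<in> Obj C" using HomD f g by blast+
    show "e Z \<cdot> amap R (g \<cdot> f) = e Z \<cdot> amap R g \<cdot> amap R f"
      using RA[OF comp_closed[OF f g]] RA[OF f] RA[OF g]
        comp_assoc[OF RA(1)[OF f] RA(1)[OF g] e[OF Z]] comp_assoc[OF RA(1)[OF f] e[OF Y] g]
        comp_assoc[OF e[OF X] f g] by simp
    show "A X \<in> S" "Z \<in> Obj C" using A X Z by auto
    show "amap R (g \<cdot> f) \<in> Hom C (A X) (A Z)" using RA comp_closed f g by blast
    show "amap R g \<cdot> amap R f \<in> Hom C (A X) (A Z)" using RA comp_closed f g by blast
  qed
  have "is_functor (full_sub C S) C id_functor"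
    using S by (auto simp: is_functor_def Hom_full_sub split: if_splits)
  moreover have "is_functor C (full_sub C S) R"
    using A RA Rid Rcomp HomD unfolding is_functor_def Hom_full_sub RO full_sub_simps
    by (smt (verit, best))
  moreover have "nat_trans (full_sub C S) (full_sub C S) id_functor (comp_functor R id_functor) \<eta>"
  proof -
    have "\<eta> Y \<cdot> f = amap R f \<cdot> \<eta> X" if "X \<in> S" "Y \<in> S" and f: "f \<in> Hom C X Y" for X Y f
    proof (rule uniq[of X _ Y])
      have X: "X \<in> Obj C" and Y: "Y \<in> Obj C" using HomD f by blast+
      show "\<eta> Y \<cdot> f \<in> Hom C X (A Y)" "amap R f \<cdot> \<eta> X \<in> Hom C X (A Y)"
        using comp_closed eta that RA by blast+
      show "e Y \<cdot> \<eta> Y \<cdot> f = e Y \<cdot> amap R f \<cdot> \<eta> X"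
        using comp_assoc[OF f eta(1) e[OF Y]] comp_assoc[OF eta(1) RA(1)[OF f] e[OF Y]]
          comp_assoc[OF eta(1) e[OF X] f] eta RA[OF f] that id_left[OF f] id_right[OF f] by simp
    qed (use that HomD in auto)
    then show ?thesis using A eta S
      by (auto simp: nat_trans_def Hom_full_sub RO split: if_splits)
  qed
  moreover have "nat_trans C C (comp_functor id_functor R) id_functor e"
    using e RA by (auto simp: nat_trans_def RO)
  moreover have "amap R (e Y) \<cdot> \<eta> (A Y) = Id C (A Y)" if Y: "Y \<in> Obj C" for Y
  proof (rule uniq[of "A Y" _ Y])
    have AY: "A Y \<in> S" "A Y \<in> Obj C" using A[OF Y] S by auto
    show "amap R (e Y) \<cdot> \<eta> (A Y) \<in> Hom C (A Y) (A Y)" using comp_closed eta AY RA e Y by blast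
    show "Id C (A Y) \<in> Hom C (A Y) (A Y)" by (rule id_closed[OF AY(2)])
    show "e Y \<cdot> amap R (e Y) \<cdot> \<eta> (A Y) = e Y \<cdot> Id C (A Y)"
      using comp_assoc[OF eta(1)[OF AY(1)] RA(1)[OF e[OF Y]] e[OF Y]]
        comp_assoc[OF eta(1)[OF AY(1)] e[OF AY(2)] e[OF Y]] RA[OF e[OF Y]] eta[OF AY(1)] by simp
  qed (use that A in auto)
  ultimately have "adjunction (full_sub C S) C id_functor R \<eta> e"
    using eta by (auto simp: adjunction_def RO)
  then show ?thesis by blast
qed

text \<open>The converse passage: whichever right adjoint and counit have been chosen, the factorization of
  \<open>b : B \<rightarrow> X\<close> through the counit is the adjunct \<open>R b \<cdot> \<eta> B\<close>. Hence results about truncations do not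
  depend on the choice.\<close>

lemma adjunction_coreflection_arr:
  assumes S: "S \<subseteq> Obj C" and adj: "adjunction (full_sub C S) C id_functor R \<eta> \<epsilon>" and X: "X \<in> Obj C"
  shows "coreflection_arr C S X (omap R X) (\<epsilon> X)"
proof -
  have R: "omap R Y \<in> S" if "Y \<in> Obj C" for Y
    using adj that by (auto simp: adjunction_def is_functor_def)
  have Rf: "amap R f \<in> Hom C (omap R Y) (omap R Z)" if f: "f \<in> Hom C Y Z" for f Y Z
  proof -
    have "amap R f \<in> Hom (full_sub C S) (omap R Y) (omap R Z)"
      using adj f by (auto simp: adjunction_def is_functor_def)
    then show ?thesis by (auto simp: Hom_full_sub split: if_splits)
  qed
  have Rc: "amap R (g \<cdot> f) = amap R g \<cdot> amap R f" if "f \<in> Hom C W Y" "g \<in> Hom C Y Z" for f g W Y Z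
    using adj that unfolding adjunction_def is_functor_def full_sub_simps by blast
  have ep: "\<epsilon> Y \<in> Hom C (omap R Y) Y" if "Y \<in> Obj C" for Y
    using adj that by (auto simp: adjunction_def nat_trans_def)
  have epn: "\<epsilon> Z \<cdot> amap R f = f \<cdot> \<epsilon> Y" if "f \<in> Hom C Y Z" for f Y Z
    using adj that by (auto simp: adjunction_def nat_trans_def)
  have et: "\<eta> Y \<in> Hom C Y (omap R Y)" if "Y \<in> S" for Y
  proof -
    have "\<eta> Y \<in> Hom (full_sub C S) Y (omap R Y)"
      using adj that by (auto simp: adjunction_def nat_trans_def)
    then show ?thesis by (auto simp: Hom_full_sub split: if_splits)
  qed
  have etn: "\<eta> Z \<cdot> f = amap R f \<cdot> \<eta> Y" if "f \<in> Hom C Y Z" "Y \<in> S" "Z \<in> S" for f Y Z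
  proof -
    have "f \<in> Hom (full_sub C S) Y Z" using that by (auto simp: Hom_full_sub)
    then show ?thesis using adj by (auto simp: adjunction_def nat_trans_def)
  qed
  have t1: "\<epsilon> Y \<cdot> \<eta> Y = Id C Y" if "Y \<in> S" for Y
    using adj that by (auto simp: adjunction_def)
  have t2: "amap R (\<epsilon> X) \<cdot> \<eta> (omap R X) = Id C (omap R X)"
    using adj X by (auto simp: adjunction_def)
  have "\<exists>!c. c \<in> Hom C B (omap R X) \<and> \<epsilon> X \<cdot> c = b" if B: "B \<in> S" and b: "b \<in> Hom C B X" for B b
  proof (rule ex1I[of _ "amap R b \<cdot> \<eta> B"])
    have BO: "B \<in> Obj C" using B S by auto
    show "amap R b \<cdot> \<eta> B \<in> Hom C B (omap R X) \<and> \<epsilon> X \<cdot> amap R b \<cdot> \<eta> B = b"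
      using comp_closed[OF et[OF B] Rf[OF b]] comp_assoc[OF et[OF B] Rf[OF b] ep[OF X]]
        comp_assoc[OF et[OF B] ep[OF BO] b] epn[OF b] t1[OF B] id_right[OF b] by simp
  next
    fix c assume "c \<in> Hom C B (omap R X) \<and> \<epsilon> X \<cdot> c = b"
    then have c: "c \<in> Hom C B (omap R X)" and cb: "\<epsilon> X \<cdot> c = b" by auto
    have RX: "omap R X \<in> S" using R X by blast
    have "amap R b \<cdot> \<eta> B = (amap R (\<epsilon> X) \<cdot> amap R c) \<cdot> \<eta> B"
      using Rc[OF c ep[OF X]] cb by simp
    also have "\<dots> = amap R (\<epsilon> X) \<cdot> \<eta> (omap R X) \<cdot> c"
      using comp_assoc[OF et[OF B] Rf[OF c] Rf[OF ep[OF X]]] etn[OF c B RX] by simp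
    also have "\<dots> = c"
      using comp_assoc[OF c et[OF RX] Rf[OF ep[OF X]]] t2 id_left[OF c] by simp
    finally show "c = amap R b \<cdot> \<eta> B" by simp
  qed
  then show ?thesis using R[OF X] ep[OF X] by (auto simp: coreflection_arr_def)
qed

text \<open>The reason why regularity only sees the union of the chain: a map \<open>B \<rightarrow> X\<close> with \<open>B \<in> S n\<close> factors
  through \<open>e n\<close>, so agreeing after composition with every \<open>e n\<close> is the same as agreeing on all maps from
  objects of the union. The definite description is the transition map between the coreflections,
  in the form in which it occurs in the limit.\<close>

lemma injective_into_coreflection_limit_iff:
  assumes X: "X \<in> Obj C" and mono: "\<And>m n. m \<le> n \<Longrightarrow> S m \<subseteq> S n"
    and S: "\<And>n::int. coreflection_arr C (S n) X (A n) (e n)"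
  shows "injective_map (\<lambda>f n. f \<cdot> e n) (Hom C X Y)
      (inv_lim (\<lambda>n. Hom C (A n) Y) (\<lambda>m n \<phi>. \<phi> \<cdot> (THE t. t \<in> Hom C (A m) (A n) \<and> e n \<cdot> t = e m))) \<longleftrightarrow>
    (\<forall>f\<in>Hom C X Y. \<forall>f'\<in>Hom C X Y. (\<forall>B\<in>(\<Union>n. S n). \<forall>b\<in>Hom C B X. f \<cdot> b = f' \<cdot> b) \<longrightarrow> f = f')"
    (is "injective_map ?F ?H ?L \<longleftrightarrow> ?R")
proof -
  have A: "A n \<in> S n" and e: "e n \<in> Hom C (A n) X" for n
    using S[of n] by (auto simp: coreflection_arr_def)
  have t: "(THE t. t \<in> Hom C (A m) (A n) \<and> e n \<cdot> t = e m) \<in> Hom C (A m) (A n) \<and>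
      e n \<cdot> (THE t. t \<in> Hom C (A m) (A n) \<and> e n \<cdot> t = e m) = e m" if "m \<le> n" for m n
  proof (rule theI')
    have "A m \<in> S n" using A mono[OF that] by blast
    then show "\<exists>!t. t \<in> Hom C (A m) (A n) \<and> e n \<cdot> t = e m"
      using S[of n] e[of m] unfolding coreflection_arr_def by blast
  qed
  have into: "?F ` ?H \<subseteq> ?L"
  proof (clarsimp simp: inv_lim_def, intro conjI allI impI)
    fix f n assume f: "f \<in> Hom C X Y"
    show "f \<cdot> e n \<in> Hom C (A n) Y" by (rule comp_closed[OF e f])
    fix m assume "m \<le> n"
    from t[OF this] show "(f \<cdot> e n) \<cdot> (THE t. t \<in> Hom C (A m) (A n) \<and> e n \<cdot> t = e m) = f \<cdot> e m"
      using comp_assoc[OF _ e f] by metis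
  qed
  have "(\<forall>n. f \<cdot> e n = f' \<cdot> e n) \<longleftrightarrow> (\<forall>B\<in>(\<Union>n. S n). \<forall>b\<in>Hom C B X. f \<cdot> b = f' \<cdot> b)"
    if f: "f \<in> Hom C X Y" and f': "f' \<in> Hom C X Y" for f f'
  proof
    assume eq: "\<forall>n. f \<cdot> e n = f' \<cdot> e n"
    show "\<forall>B\<in>(\<Union>n. S n). \<forall>b\<in>Hom C B X. f \<cdot> b = f' \<cdot> b"
    proof (intro ballI, clarify)
      fix B n b assume "B \<in> S n" "b \<in> Hom C B X"
      then obtain c where "c \<in> Hom C B (A n)" "e n \<cdot> c = b"
        using S[of n] unfolding coreflection_arr_def by metis
      then show "f \<cdot> b = f' \<cdot> b" using comp_assoc[OF _ e f] comp_assoc[OF _ e f'] eq by metis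
    qed
  qed (use A e in blast)
  then show ?thesis using into unfolding injective_map_def inj_on_def fun_eq_iff by blast
qed

end

section \<open>Isomorphisms and fully faithful functors\<close>

context category
begin

lemma iso_arr_iff:
  assumes "f \<in> Hom C X Y"
  shows "iso_arr C f \<longleftrightarrow> (\<exists>g\<in>Hom C Y X. g \<cdot> f = Id C X \<and> f \<cdot> g = Id C Y)"
  using assms by (auto simp: iso_arr_def Hom_def)

lemma isomorphic_iff:
  "isomorphic C X Y \<longleftrightarrow> (\<exists>f\<in>Hom C X Y. \<exists>g\<in>Hom C Y X. g \<cdot> f = Id C X \<and> f \<cdot> g = Id C Y)"
  using iso_arr_iff unfolding isomorphic_def by blast

lemma iso_arr_Id: "X \<in> Obj C \<Longrightarrow> iso_arr C (Id C X)"
  using iso_arr_iff[OF id_closed] id_closed id_left[OF id_closed] by blast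

lemma isomorphic_refl: "X \<in> Obj C \<Longrightarrow> isomorphic C X X"
  unfolding isomorphic_def using id_closed iso_arr_Id by blast

lemma isomorphic_sym: "isomorphic C X Y \<Longrightarrow> isomorphic C Y X"
  unfolding isomorphic_iff by blast

lemma isomorphic_Obj: "isomorphic C X Y \<Longrightarrow> X \<in> Obj C \<and> Y \<in> Obj C"
  unfolding isomorphic_def using HomD by blast

lemma isomorphic_trans:
  assumes "isomorphic C X Y" "isomorphic C Y Z"
  shows "isomorphic C X Z"
proof -
  obtain f f' where f: "f \<in> Hom C X Y" "f' \<in> Hom C Y X" "f' \<cdot> f = Id C X" "f \<cdot> f' = Id C Y"
    using assms(1) unfolding isomorphic_iff by blast
  obtain g g' where g: "g \<in> Hom C Y Z" "g' \<in> Hom C Z Y" "g' \<cdot> g = Id C Y" "g \<cdot> g' = Id C Z"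
    using assms(2) unfolding isomorphic_iff by blast
  have "(f' \<cdot> g') \<cdot> g \<cdot> f = Id C X"
    using comp_assoc[OF comp_closed[OF f(1) g(1)] g(2) f(2)] comp_assoc[OF f(1) g(1) g(2)]
      g(3) id_left[OF f(1)] f(3) by simp
  moreover have "(g \<cdot> f) \<cdot> f' \<cdot> g' = Id C Z"
    using comp_assoc[OF comp_closed[OF g(2) f(2)] f(1) g(1)] comp_assoc[OF g(2) f(2) f(1)]
      f(4) id_left[OF g(2)] g(4) by simp
  ultimately show ?thesis
    using comp_closed[OF f(1) g(1)] comp_closed[OF g(2) f(2)] unfolding isomorphic_iff by blast
qed

lemma isomorphic_functor:
  assumes F: "is_functor C C F" and iso: "isomorphic C X Y"
  shows "isomorphic C (omap F X) (omap F Y)"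
proof -
  obtain f f' where f: "f \<in> Hom C X Y" "f' \<in> Hom C Y X" "f' \<cdot> f = Id C X" "f \<cdot> f' = Id C Y"
    using iso unfolding isomorphic_iff by blast
  have "amap F f' \<cdot> amap F f = Id C (omap F X)" "amap F f \<cdot> amap F f' = Id C (omap F Y)"
    using F f HomD[OF f(1)] unfolding is_functor_def by metis+
  then show ?thesis using F f unfolding isomorphic_iff is_functor_def by blast
qed

text \<open>In an additive category this says that the Hom group vanishes. Avoiding the zero map makes it
  transfer along isomorphisms and along any fully faithful functor.\<close>

definition subsingleton_Hom :: "'o \<Rightarrow> 'o \<Rightarrow> bool" where
  "subsingleton_Hom X Y \<longleftrightarrow> (\<forall>f\<in>Hom C X Y. \<forall>g\<in>Hom C X Y. f = g)"

lemma subsingleton_Hom_isomorphic: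
  assumes "isomorphic C X X'" "isomorphic C Y Y'" "subsingleton_Hom X Y"
  shows "subsingleton_Hom X' Y'"
  unfolding subsingleton_Hom_def
proof (intro ballI)
  fix f g assume f: "f \<in> Hom C X' Y'" and g: "g \<in> Hom C X' Y'"
  obtain u u' where u: "u \<in> Hom C X X'" "u' \<in> Hom C X' X" "u \<cdot> u' = Id C X'"
    using assms(1) unfolding isomorphic_iff by blast
  obtain v v' where v: "v \<in> Hom C Y Y'" "v' \<in> Hom C Y' Y" "v \<cdot> v' = Id C Y'"
    using assms(2) unfolding isomorphic_iff by blast
  have conj_eq: "h = v \<cdot> (v' \<cdot> h \<cdot> u) \<cdot> u'" if h: "h \<in> Hom C X' Y'" for h
  proof -
    have "(v' \<cdot> h \<cdot> u) \<cdot> u' = v' \<cdot> h"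
      using comp_assoc[OF u(2) comp_closed[OF u(1) h] v(2)] comp_assoc[OF u(2) u(1) h]
        u(3) id_right[OF h] by simp
    then show ?thesis using comp_assoc[OF h v(2) v(1)] v(3) id_left[OF h] by simp
  qed
  have "v' \<cdot> f \<cdot> u \<in> Hom C X Y" "v' \<cdot> g \<cdot> u \<in> Hom C X Y"
    using comp_closed u v f g by blast+
  then have "v' \<cdot> f \<cdot> u = v' \<cdot> g \<cdot> u"
    using assms(3) unfolding subsingleton_Hom_def by blast
  with conj_eq[OF f] conj_eq[OF g] show "f = g" by simp
qed

lemma faithful_if_left_inverse:
  assumes F: "is_functor C C F" and t: "nat_iso C C (comp_functor G F) id_functor t"
    and f: "f \<in> Hom C X Y" and g: "g \<in> Hom C X Y" and eq: "amap F f = amap F g"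
  shows "f = g"
proof -
  have X: "X \<in> Obj C" using HomD f by blast
  have tX: "t X \<in> Hom C (omap G (omap F X)) X" and iso: "iso_arr C (t X)"
    using t X by (auto simp: nat_iso_def nat_trans_def)
  have "f \<cdot> t X = g \<cdot> t X"
    using t f g eq unfolding nat_iso_def nat_trans_def comp_functor_simps id_functor_simps by metis
  moreover obtain s where s: "s \<in> Hom C X (omap G (omap F X))" "t X \<cdot> s = Id C X"
    using iso iso_arr_iff[OF tX] by blast
  ultimately show ?thesis
    using comp_assoc[OF s(1) tX f] comp_assoc[OF s(1) tX g] id_right[OF f] id_right[OF g] by metis
qed

text \<open>A preimage of \<open>b\<close> is the conjugate of \<open>G b\<close> by the isomorphism \<open>G F \<cong> id\<close>. It is mapped to \<open>b\<close> because
  \<open>G\<close> is faithful, which is where the other isomorphism enters.\<close>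

lemma full_if_equivalence:
  assumes F: "is_functor C C F" and G: "is_functor C C G"
    and t: "nat_iso C C (comp_functor G F) id_functor t"
    and t': "nat_iso C C (comp_functor F G) id_functor t'"
    and X: "X \<in> Obj C" and Y: "Y \<in> Obj C" and b: "b \<in> Hom C (omap F X) (omap F Y)"
  shows "\<exists>a\<in>Hom C X Y. amap F a = b"
proof -
  have tn: "t Z \<in> Hom C (omap G (omap F Z)) Z" "iso_arr C (t Z)" if "Z \<in> Obj C" for Z
    using t that by (auto simp: nat_iso_def nat_trans_def)
  obtain s where s: "s \<in> Hom C X (omap G (omap F X))" "s \<cdot> t X = Id C (omap G (omap F X))"
    using tn[OF X] iso_arr_iff by blast
  obtain r where r: "r \<in> Hom C Y (omap G (omap F Y))" "r \<cdot> t Y = Id C (omap G (omap F Y))"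
    using tn[OF Y] iso_arr_iff by blast
  have Gb: "amap G b \<in> Hom C (omap G (omap F X)) (omap G (omap F Y))"
    using G b by (auto simp: is_functor_def)
  define a where "a = t Y \<cdot> amap G b \<cdot> s"
  have a: "a \<in> Hom C X Y" using comp_closed tn X Y s Gb unfolding a_def by blast
  have Fa: "amap F a \<in> Hom C (omap F X) (omap F Y)" using F a by (auto simp: is_functor_def)
  have GFa: "amap G (amap F a) \<in> Hom C (omap G (omap F X)) (omap G (omap F Y))"
    using G Fa by (auto simp: is_functor_def)
  have "t Y \<cdot> amap G (amap F a) = a \<cdot> t X"
    using t a by (auto simp: nat_iso_def nat_trans_def)
  also have "\<dots> = t Y \<cdot> amap G b"
    unfolding a_def
    using comp_assoc[OF tn(1)[OF X] comp_closed[OF s(1) Gb] tn(1)[OF Y]]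
      comp_assoc[OF tn(1)[OF X] s(1) Gb] s(2) id_right[OF Gb] by simp
  finally have "amap G (amap F a) = amap G b"
    using comp_assoc[OF GFa tn(1)[OF Y] r(1)] comp_assoc[OF Gb tn(1)[OF Y] r(1)] r(2)
      id_left[OF GFa] id_left[OF Gb] by simp
  then have "amap F a = b" by (rule faithful_if_left_inverse[OF G t' Fa b])
  with a show ?thesis by blast
qed

end

section \<open>Additive categories\<close>

context additive_category
begin

lemma hom_group_simps:
  "carrier (hom_group C X Y) = Hom C X Y" "mult (hom_group C X Y) = Add C"
  "one (hom_group C X Y) = Zero C X Y"
  by (auto simp: hom_group_def)

lemma Zero_closed: "\<lbrakk>X \<in> Obj C; Y \<in> Obj C\<rbrakk> \<Longrightarrow> Zero C X Y \<in> Hom C X Y"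
  using group.is_monoid[OF comm_group.axioms(2)[OF hom_comm_group]] monoid.one_closed
  unfolding hom_group_simps[symmetric] by blast

lemma hom_group: "\<lbrakk>X \<in> Obj C; Y \<in> Obj C\<rbrakk> \<Longrightarrow> group (hom_group C X Y)"
  using comm_group.axioms(2)[OF hom_comm_group] .

lemma Add_closed: "\<lbrakk>f \<in> Hom C X Y; g \<in> Hom C X Y\<rbrakk> \<Longrightarrow> f \<boxplus> g \<in> Hom C X Y"
  using monoid.m_closed[OF group.is_monoid[OF hom_group]] HomD unfolding hom_group_simps by metis

lemma Neg_eq: "f \<in> Hom C X Y \<Longrightarrow> Neg C f = inv\<^bsub>hom_group C X Y\<^esub> f"
  by (auto simp: Neg_def Hom_def)

lemma Neg_closed: "f \<in> Hom C X Y \<Longrightarrow> Neg C f \<in> Hom C X Y"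
  using group.inv_closed[OF hom_group] HomD Neg_eq unfolding hom_group_simps by metis

lemma Neg_Neg: "f \<in> Hom C X Y \<Longrightarrow> Neg C (Neg C f) = f"
  using group.inv_inv[OF hom_group] HomD Neg_eq Neg_closed unfolding hom_group_simps by metis

lemma Add_Neg: "f \<in> Hom C X Y \<Longrightarrow> f \<boxplus> Neg C f = Zero C X Y"
  using group.r_inv[OF hom_group] HomD Neg_eq unfolding hom_group_simps by metis

lemma Neg_unique:
  "\<lbrakk>f \<in> Hom C X Y; g \<in> Hom C X Y; f \<boxplus> g = Zero C X Y\<rbrakk> \<Longrightarrow> g = Neg C f"
  using group.inv_equality[OF hom_group] comm_groupE(4)[OF hom_comm_group] HomD Neg_eq
  unfolding hom_group_simps by metis

lemma idempotent_Zero: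
  assumes "f \<in> Hom C X Y" "f \<boxplus> f = f"
  shows "f = Zero C X Y"
  using group.l_cancel_one[OF hom_group, of X Y f f] HomD[OF assms(1)] assms
  unfolding hom_group_simps by metis

lemma Zero_Add_Zero: "\<lbrakk>X \<in> Obj C; Y \<in> Obj C\<rbrakk> \<Longrightarrow> Zero C X Y \<boxplus> Zero C X Y = Zero C X Y"
  using monoid.l_one[OF group.is_monoid[OF hom_group]] Zero_closed unfolding hom_group_simps by metis

lemma comp_Zero_left:
  assumes "f \<in> Hom C X Y" "Z \<in> Obj C"
  shows "Zero C Y Z \<cdot> f = Zero C X Z"
proof (rule idempotent_Zero)
  have z: "Zero C Y Z \<in> Hom C Y Z" using Zero_closed HomD assms by blast
  show "Zero C Y Z \<cdot> f \<in> Hom C X Z" using comp_closed[OF assms(1) z] .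
  show "(Zero C Y Z \<cdot> f) \<boxplus> (Zero C Y Z \<cdot> f) = Zero C Y Z \<cdot> f"
    using comp_add_left[OF assms(1) z z] Zero_Add_Zero HomD assms by metis
qed

lemma comp_Zero_right:
  assumes "g \<in> Hom C Y Z" "X \<in> Obj C"
  shows "g \<cdot> Zero C X Y = Zero C X Z"
proof (rule idempotent_Zero)
  have z: "Zero C X Y \<in> Hom C X Y" using Zero_closed HomD assms by blast
  show "g \<cdot> Zero C X Y \<in> Hom C X Z" using comp_closed[OF z assms(1)] .
  show "(g \<cdot> Zero C X Y) \<boxplus> (g \<cdot> Zero C X Y) = g \<cdot> Zero C X Y"
    using comp_add_right[OF z z assms(1)] Zero_Add_Zero HomD assms by metis
qed

lemma Neg_comp_left:
  assumes f: "f \<in> Hom C X Y" and g: "g \<in> Hom C Y Z"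
  shows "Neg C g \<cdot> f = Neg C (g \<cdot> f)"
  by (rule Neg_unique[OF comp_closed[OF f g] comp_closed[OF f Neg_closed[OF g]]])
    (use comp_add_left[OF f g Neg_closed[OF g]] Add_Neg[OF g] comp_Zero_left[OF f] HomD[OF g] in simp)

lemma Neg_comp_right:
  assumes f: "f \<in> Hom C X Y" and g: "g \<in> Hom C Y Z"
  shows "g \<cdot> Neg C f = Neg C (g \<cdot> f)"
  by (rule Neg_unique[OF comp_closed[OF f g] comp_closed[OF Neg_closed[OF f] g]])
    (use comp_add_right[OF f Neg_closed[OF f] g] Add_Neg[OF f] comp_Zero_right[OF g] HomD[OF f] in simp)

lemma Neg_Zero: "\<lbrakk>X \<in> Obj C; Y \<in> Obj C\<rbrakk> \<Longrightarrow> Neg C (Zero C X Y) = Zero C X Y"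
  using Neg_unique[OF Zero_closed Zero_closed Zero_Add_Zero] by metis

lemma eq_if_Add_Neg_Zero:
  assumes "f \<in> Hom C X Y" "g \<in> Hom C X Y" "f \<boxplus> Neg C g = Zero C X Y"
  shows "f = g"
  using Neg_unique[OF assms(1) Neg_closed[OF assms(2)] assms(3)] Neg_Neg assms by metis

lemma subsingleton_Hom_iff:
  "\<lbrakk>X \<in> Obj C; Y \<in> Obj C\<rbrakk> \<Longrightarrow> subsingleton_Hom X Y \<longleftrightarrow> Hom C X Y = {Zero C X Y}"
  unfolding subsingleton_Hom_def using Zero_closed[of X Y] by auto

lemma comp_left_injI:
  assumes g: "g \<in> Hom C Y Z" and ker: "\<And>c. \<lbrakk>c \<in> Hom C X Y; g \<cdot> c = Zero C X Z\<rbrakk> \<Longrightarrow> c = Zero C X Y"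
    and f: "f \<in> Hom C X Y" and f': "f' \<in> Hom C X Y" and eq: "g \<cdot> f = g \<cdot> f'"
  shows "f = f'"
proof (rule eq_if_Add_Neg_Zero[OF f f' ker])
  show "g \<cdot> (f \<boxplus> Neg C f') = Zero C X Z"
    using comp_add_right[OF f Neg_closed[OF f'] g] Neg_comp_right[OF f' g] eq
      Add_Neg[OF comp_closed[OF f' g]] by simp
qed (rule Add_closed[OF f Neg_closed[OF f']])

lemma comp_right_injI:
  assumes g: "g \<in> Hom C X Y" and ker: "\<And>c. \<lbrakk>c \<in> Hom C Y Z; c \<cdot> g = Zero C X Z\<rbrakk> \<Longrightarrow> c = Zero C Y Z"
    and f: "f \<in> Hom C Y Z" and f': "f' \<in> Hom C Y Z" and eq: "f \<cdot> g = f' \<cdot> g"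
  shows "f = f'"
proof (rule eq_if_Add_Neg_Zero[OF f f' ker])
  show "(f \<boxplus> Neg C f') \<cdot> g = Zero C X Z"
    using comp_add_left[OF g f Neg_closed[OF f']] Neg_comp_left[OF g f'] eq
      Add_Neg[OF comp_closed[OF g f']] by simp
qed (rule Add_closed[OF f Neg_closed[OF f']])

end

section \<open>The translation functor and exactness of Hom\<close>

context triangulated_category
begin

abbreviation \<Sigma> :: "'o \<Rightarrow> 'o" where "\<Sigma> \<equiv> omap (Sig T)"
abbreviation \<Sigma>a :: "'m \<Rightarrow> 'm" where "\<Sigma>a \<equiv> amap (Sig T)"

lemma Sig_Obj: "X \<in> Obj T \<Longrightarrow> \<Sigma> X \<in> Obj T"
  and Sig_Hom: "f \<in> Hom T X Y \<Longrightarrow> \<Sigma>a f \<in> Hom T (\<Sigma> X) (\<Sigma> Y)"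
  and Sig_comp: "\<lbrakk>f \<in> Hom T X Y; g \<in> Hom T Y Z\<rbrakk> \<Longrightarrow> \<Sigma>a (g \<cdot> f) = \<Sigma>a g \<cdot> \<Sigma>a f"
  using sig_functor by (auto simp: is_functor_def)

lemma Sig_inv_Obj: "X \<in> Obj T \<Longrightarrow> omap (Sig_inv T) X \<in> Obj T"
  using sig_inv_functor by (auto simp: is_functor_def)

lemma Sig_faithful: "\<lbrakk>f \<in> Hom T X Y; g \<in> Hom T X Y; \<Sigma>a f = \<Sigma>a g\<rbrakk> \<Longrightarrow> f = g"
  using faithful_if_left_inverse[OF sig_functor] sig_inv_sig by blast

lemma Sig_full: "\<lbrakk>X \<in> Obj T; Y \<in> Obj T; b \<in> Hom T (\<Sigma> X) (\<Sigma> Y)\<rbrakk> \<Longrightarrow> \<exists>a\<in>Hom T X Y. \<Sigma>a a = b"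
  using full_if_equivalence[OF sig_functor sig_inv_functor] sig_inv_sig sig_sig_inv by blast

lemma Sig_Sig_inv: "X \<in> Obj T \<Longrightarrow> isomorphic T (\<Sigma> (omap (Sig_inv T) X)) X"
  using sig_sig_inv unfolding nat_iso_def nat_trans_def isomorphic_def by force

lemma Sig_inv_Sig: "X \<in> Obj T \<Longrightarrow> isomorphic T (omap (Sig_inv T) (\<Sigma> X)) X"
  using sig_inv_sig unfolding nat_iso_def nat_trans_def isomorphic_def by force

lemma Sig_Zero:
  assumes "X \<in> Obj T" "Y \<in> Obj T"
  shows "\<Sigma>a (Zero T X Y) = Zero T (\<Sigma> X) (\<Sigma> Y)"
proof (rule idempotent_Zero)
  have z: "Zero T X Y \<in> Hom T X Y" using Zero_closed assms by blast
  show "\<Sigma>a (Zero T X Y) \<in> Hom T (\<Sigma> X) (\<Sigma> Y)" using Sig_Hom[OF z] .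
  show "\<Sigma>a (Zero T X Y) \<boxplus> \<Sigma>a (Zero T X Y) = \<Sigma>a (Zero T X Y)"
    using sig_add[OF z z] Zero_Add_Zero[OF assms] by simp
qed

lemma subsingleton_Hom_Sig:
  assumes "X \<in> Obj T" "Y \<in> Obj T"
  shows "subsingleton_Hom (\<Sigma> X) (\<Sigma> Y) \<longleftrightarrow> subsingleton_Hom X Y"
proof
  assume "subsingleton_Hom (\<Sigma> X) (\<Sigma> Y)"
  then show "subsingleton_Hom X Y"
    using Sig_faithful Sig_Hom unfolding subsingleton_Hom_def by meson
next
  assume "subsingleton_Hom X Y"
  then show "subsingleton_Hom (\<Sigma> X) (\<Sigma> Y)"
    using Sig_full[OF assms] unfolding subsingleton_Hom_def by metis
qed

lemma zero_obj_iff: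
  "zero_obj T Z \<longleftrightarrow> Z \<in> Obj T \<and> (\<forall>X\<in>Obj T. subsingleton_Hom X Z \<and> subsingleton_Hom Z X)"
  unfolding zero_obj_def subsingleton_Hom_def using Zero_closed by blast

lemma zero_obj_Sig:
  assumes "zero_obj T Z"
  shows "zero_obj T (\<Sigma> Z)"
proof -
  have Z: "Z \<in> Obj T" using assms by (simp add: zero_obj_def)
  have "subsingleton_Hom X (\<Sigma> Z) \<and> subsingleton_Hom (\<Sigma> Z) X" if X: "X \<in> Obj T" for X
  proof -
    let ?X = "omap (Sig_inv T) X"
    have X': "?X \<in> Obj T" "isomorphic T (\<Sigma> ?X) X" using Sig_inv_Obj Sig_Sig_inv X by auto
    then have "subsingleton_Hom (\<Sigma> ?X) (\<Sigma> Z)" "subsingleton_Hom (\<Sigma> Z) (\<Sigma> ?X)"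
      using assms Z subsingleton_Hom_Sig unfolding zero_obj_iff by auto
    then show ?thesis
      using subsingleton_Hom_isomorphic X'(2) isomorphic_refl[OF Sig_Obj[OF Z]] by blast
  qed
  then show ?thesis using Sig_Obj[OF Z] unfolding zero_obj_iff by blast
qed

definition exact_at :: "'o \<Rightarrow> 'o \<Rightarrow> 'o \<Rightarrow> 'm \<Rightarrow> 'm \<Rightarrow> 'm \<Rightarrow> bool" where
  "exact_at X Y Z f g h \<longleftrightarrow>
    f \<in> Hom T X Y \<and> g \<in> Hom T Y Z \<and> h \<in> Hom T Z (\<Sigma> X) \<and> (f, g, h) \<in> Exact T"

lemma rotate_iff:
  assumes "f \<in> Hom T X Y" "g \<in> Hom T Y Z" "h \<in> Hom T Z (\<Sigma> X)"
  shows "exact_at Y Z (\<Sigma> X) g h (Neg T (\<Sigma>a f)) \<longleftrightarrow> exact_at X Y Z f g h"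
proof -
  have "triangle T f g h" unfolding triangle_def using assms by blast
  from TR2[OF this] show ?thesis
    using assms Neg_closed[OF Sig_Hom[OF assms(1)]] by (simp add: exact_at_def)
qed

lemma rotate: "exact_at X Y Z f g h \<Longrightarrow> exact_at Y Z (\<Sigma> X) g h (Neg T (\<Sigma>a f))"
  using rotate_iff[of f X Y g Z h] by (simp add: exact_at_def)

text \<open>The companion of the axiom on identity triangles, with the zero object in first place. It is a backward
  rotation of the identity triangle ending in the zero object \<open>\<Sigma> Z\<close>.\<close>

lemma exact_Id_right:
  assumes W: "W \<in> Obj T" and Z: "zero_obj T Z"
  shows "exact_at Z W W (Zero T Z W) (Id T W) (Zero T W (\<Sigma> Z))"
proof -
  have Zo: "Z \<in> Obj T" using Z by (simp add: zero_obj_def)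
  note [simp] = Sig_Obj Zo W
  have "Neg T (\<Sigma>a (Zero T Z W)) = Zero T (\<Sigma> Z) (\<Sigma> W)"
    by (simp add: Sig_Zero Neg_Zero)
  then show ?thesis
    using rotate_iff[of "Zero T Z W" Z W "Id T W" W "Zero T W (\<Sigma> Z)"]
      TR1_id[OF W zero_obj_Sig[OF Z]] Zero_closed id_closed[OF W] by (simp add: exact_at_def)
qed

lemma exact_Id_left:
  assumes W: "W \<in> Obj T" and Z: "zero_obj T Z"
  shows "exact_at W W Z (Id T W) (Zero T W Z) (Zero T Z (\<Sigma> W))"
  using assms TR1_id Zero_closed id_closed Sig_Obj by (auto simp: exact_at_def zero_obj_def)

lemma exact_morphism:
  assumes "exact_at X Y Z f g h" "exact_at X' Y' Z' f' g' h'"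
    and "u \<in> Hom T X X'" "v \<in> Hom T Y Y'" "v \<cdot> f = f' \<cdot> u"
  shows "\<exists>w\<in>Hom T Z Z'. w \<cdot> g = g' \<cdot> v \<and> \<Sigma>a u \<cdot> h = h' \<cdot> w"
proof -
  have "Dom T f = X" "Dom T g = Y" "Dom T h = Z" "Dom T f' = X'" "Dom T g' = Y'" "Dom T h' = Z'"
    using assms(1,2) by (auto simp: exact_at_def Hom_def)
  then show ?thesis using TR3[of f g h f' g' h' u v] assms by (auto simp: exact_at_def)
qed

text \<open>Exactness of \<open>Hom(-, W)\<close>: a map \<open>a\<close> killed by \<open>f\<close> gives the first square of a morphism of triangles from
  the given one to \<open>0 \<rightarrow> W \<rightarrow> W \<rightarrow> \<Sigma> 0\<close>, and the third component of that morphism is the factorization.\<close>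

lemma exact_factor_right:
  assumes ex: "exact_at X Y Z f g h" and a: "a \<in> Hom T Y W" and zero: "a \<cdot> f = Zero T X W"
  shows "\<exists>b\<in>Hom T Z W. b \<cdot> g = a"
proof -
  obtain O' where O: "zero_obj T O'" using ex_zero_obj by blast
  have f: "f \<in> Hom T X Y" using ex by (simp add: exact_at_def)
  have objs: "O' \<in> Obj T" "X \<in> Obj T" "W \<in> Obj T" using O HomD f a by (auto simp: zero_obj_def)
  have "a \<cdot> f = Zero T O' W \<cdot> Zero T X O'"
    using zero comp_Zero_left[OF Zero_closed] objs by simp
  then obtain w where "w \<in> Hom T Z W" "w \<cdot> g = Id T W \<cdot> a"
    using exact_morphism[OF ex exact_Id_right[OF objs(3) O] Zero_closed a] objs by blast
  then show ?thesis using id_left[OF a] by auto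
qed

text \<open>Exactness of \<open>Hom(W, -)\<close>. A morphism of triangles is only supplied in the third position, so the
  argument is made for the rotated triangles; it yields the factorization of \<open>\<Sigma> a\<close>, which is then
  desuspended because \<open>\<Sigma>\<close> is fully faithful.\<close>

lemma exact_factor_left:
  assumes ex: "exact_at X Y Z f g h" and a: "a \<in> Hom T W Y" and zero: "g \<cdot> a = Zero T W Z"
  shows "\<exists>b\<in>Hom T W X. f \<cdot> b = a"
proof -
  obtain O' where O: "zero_obj T O'" using ex_zero_obj by blast
  have f: "f \<in> Hom T X Y" and g: "g \<in> Hom T Y Z" using ex by (simp_all add: exact_at_def)
  have objs: "O' \<in> Obj T" "X \<in> Obj T" "W \<in> Obj T" "Z \<in> Obj T"
    using O HomD f g a by (auto simp: zero_obj_def)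
  have "Zero T O' Z \<cdot> Zero T W O' = g \<cdot> a"
    using zero comp_Zero_left[OF Zero_closed] objs by simp
  then obtain w where w: "w \<in> Hom T (\<Sigma> W) (\<Sigma> X)"
      "\<Sigma>a a \<cdot> Neg T (\<Sigma>a (Id T W)) = Neg T (\<Sigma>a f) \<cdot> w"
    using exact_morphism[OF rotate[OF exact_Id_left[OF objs(3) O]] rotate[OF ex] a Zero_closed] objs
    by blast
  obtain b where b: "b \<in> Hom T W X" "\<Sigma>a b = w" using Sig_full[OF objs(3,2) w(1)] by blast
  have fb: "f \<cdot> b \<in> Hom T W Y" using comp_closed[OF b(1) f] .
  have "Neg T (\<Sigma>a a) = \<Sigma>a a \<cdot> Neg T (\<Sigma>a (Id T W))"
    using Neg_comp_right[OF Sig_Hom[OF id_closed[OF objs(3)]] Sig_Hom[OF a]]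
      Sig_comp[OF id_closed[OF objs(3)] a] id_right[OF a] by simp
  also have "\<dots> = Neg T (\<Sigma>a (f \<cdot> b))"
    using w(2) b(2) Neg_comp_left[OF Sig_Hom[OF b(1)] Sig_Hom[OF f]] Sig_comp[OF b(1) f] by simp
  finally have "\<Sigma>a (f \<cdot> b) = \<Sigma>a a"
    using Neg_Neg[OF Sig_Hom[OF a]] Neg_Neg[OF Sig_Hom[OF fb]] by metis
  then show ?thesis using Sig_faithful[OF fb a] b(1) by blast
qed

text \<open>If \<open>c : W \<rightarrow> X\<close> is killed by \<open>f\<close>, then \<open>\<Sigma> c\<close> factors through \<open>h : Z \<rightarrow> \<Sigma> X\<close>, hence through the zero group
  \<open>Hom(\<Sigma> W, Z)\<close>. This is the uniqueness of factorizations through a truncation.\<close>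

lemma comp_left_inj:
  assumes ex: "exact_at X Y Z f g h" and W: "subsingleton_Hom (\<Sigma> W) Z"
    and c: "c \<in> Hom T W X" and c': "c' \<in> Hom T W X" and eq: "f \<cdot> c = f \<cdot> c'"
  shows "c = c'"
proof (rule comp_left_injI[OF _ _ c c' eq])
  show f: "f \<in> Hom T X Y" using ex by (simp add: exact_at_def)
  fix c assume c: "c \<in> Hom T W X" and fc: "f \<cdot> c = Zero T W Y"
  have h: "h \<in> Hom T Z (\<Sigma> X)" using ex by (simp add: exact_at_def)
  have objs: "W \<in> Obj T" "X \<in> Obj T" "Y \<in> Obj T" "Z \<in> Obj T" "\<Sigma> W \<in> Obj T" "\<Sigma> Y \<in> Obj T"
    using HomD c f h Sig_Obj by auto
  have "Neg T (\<Sigma>a f) \<cdot> \<Sigma>a c = Zero T (\<Sigma> W) (\<Sigma> Y)"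
    using Neg_comp_left[OF Sig_Hom[OF c] Sig_Hom[OF f]] Sig_comp[OF c f, symmetric] fc Sig_Zero Neg_Zero objs
    by simp
  then obtain b where b: "b \<in> Hom T (\<Sigma> W) Z" "h \<cdot> b = \<Sigma>a c"
    using exact_factor_left[OF rotate[OF rotate[OF ex]] Sig_Hom[OF c]] by blast
  then have "b = Zero T (\<Sigma> W) Z" using W subsingleton_Hom_iff objs by blast
  then have "\<Sigma>a c = \<Sigma>a (Zero T W X)"
    using b(2) comp_Zero_right[OF h] Sig_Zero objs by simp
  then show "c = Zero T W X" using Sig_faithful[OF c Zero_closed] objs by blast
qed

text \<open>Dually, a map killed by \<open>g\<close> factors through \<open>\<Sigma> X\<close>.\<close>

lemma comp_right_inj:
  assumes ex: "exact_at X Y Z f g h" and W: "subsingleton_Hom (\<Sigma> X) W"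
    and c: "c \<in> Hom T Z W" and c': "c' \<in> Hom T Z W" and eq: "c \<cdot> g = c' \<cdot> g"
  shows "c = c'"
proof (rule comp_right_injI[OF _ _ c c' eq])
  show g: "g \<in> Hom T Y Z" using ex by (simp add: exact_at_def)
  fix c assume c: "c \<in> Hom T Z W" and cg: "c \<cdot> g = Zero T Y W"
  have h: "h \<in> Hom T Z (\<Sigma> X)" using ex by (simp add: exact_at_def)
  have objs: "W \<in> Obj T" "\<Sigma> X \<in> Obj T" using HomD c h by blast+
  obtain b where b: "b \<in> Hom T (\<Sigma> X) W" "b \<cdot> h = c"
    using exact_factor_right[OF rotate[OF ex] c cg] by blast
  then have "b = Zero T (\<Sigma> X) W" using W subsingleton_Hom_iff objs by blast
  then show "c = Zero T Z W" using b(2) comp_Zero_left[OF h] objs by simp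
qed

text \<open>Truncation arguments need a triangle with prescribed objects, but never prescribed maps. Forgetting
  the maps absorbs the signs that appear under rotation.\<close>

definition triangle_on :: "'o \<Rightarrow> 'o \<Rightarrow> 'o \<Rightarrow> bool" where
  "triangle_on X Y Z \<longleftrightarrow> (\<exists>f g h. exact_at X Y Z f g h)"

lemma triangle_on_isomorphic:
  assumes "triangle_on X Y Z" "isomorphic T X X'" "isomorphic T Y Y'" "isomorphic T Z Z'"
  shows "triangle_on X' Y' Z'"
proof -
  obtain f g h where f: "f \<in> Hom T X Y" and g: "g \<in> Hom T Y Z" and h: "h \<in> Hom T Z (\<Sigma> X)"
    and ex: "(f, g, h) \<in> Exact T"
    using assms(1) by (auto simp: triangle_on_def exact_at_def)
  obtain u u' where u: "u \<in> Hom T X X'" "iso_arr T u" "u' \<in> Hom T X' X" "u' \<cdot> u = Id T X"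
    using assms(2) iso_arr_iff unfolding isomorphic_def by metis
  obtain v v' where v: "v \<in> Hom T Y Y'" "iso_arr T v" "v' \<in> Hom T Y' Y" "v' \<cdot> v = Id T Y"
    using assms(3) iso_arr_iff unfolding isomorphic_def by metis
  obtain w w' where w: "w \<in> Hom T Z Z'" "iso_arr T w" "w' \<in> Hom T Z' Z" "w' \<cdot> w = Id T Z"
    using assms(4) iso_arr_iff unfolding isomorphic_def by metis
  have conj: "(b \<cdot> k \<cdot> a') \<cdot> a = b \<cdot> k"
    if "a \<in> Hom T A A'" "a' \<in> Hom T A' A" "a' \<cdot> a = Id T A" "k \<in> Hom T A B" "b \<in> Hom T B B'"
    for a a' b k A A' B B'
    using comp_assoc[OF that(1) comp_closed[OF that(2,4)] that(5)] comp_assoc[OF that(1,2,4)]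
      that(3) id_right[OF that(4)] by simp
  let ?f = "v \<cdot> f \<cdot> u'" and ?g = "w \<cdot> g \<cdot> v'" and ?h = "\<Sigma>a u \<cdot> h \<cdot> w'"
  have f': "?f \<in> Hom T X' Y'" and g': "?g \<in> Hom T Y' Z'" and h': "?h \<in> Hom T Z' (\<Sigma> X')"
    using comp_closed f g h u v w Sig_Hom by blast+
  have dom: "Dom T f = X" "Dom T g = Y" "Dom T h = Z" "Dom T ?f = X'" "Dom T ?g = Y'" "Dom T ?h = Z'"
    using f g h f' g' h' by (auto simp: Hom_def)
  have "(?f, ?g, ?h) \<in> Exact T"
  proof (rule TR1_iso[OF ex])
    show "triangle T ?f ?g ?h" using f' g' h' by (auto simp: triangle_def)
    show "v \<cdot> f = ?f \<cdot> u" using conj[OF u(1,3,4) f v(1)] by simp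
    show "w \<cdot> g = ?g \<cdot> v" using conj[OF v(1,3,4) g w(1)] by simp
    show "\<Sigma>a u \<cdot> h = ?h \<cdot> w" using conj[OF w(1,3,4) h Sig_Hom[OF u(1)]] by simp
  qed (use u v w dom in auto)
  then show ?thesis using f' g' h' by (auto simp: triangle_on_def exact_at_def)
qed

text \<open>Rotating three times translates a triangle and changes the sign of each of its maps. Every map between
  translates is the negative of a translate, so the process can be reversed.\<close>

lemma triangle_on_Sig:
  assumes objs: "X \<in> Obj T" "Y \<in> Obj T" "Z \<in> Obj T"
  shows "triangle_on (\<Sigma> X) (\<Sigma> Y) (\<Sigma> Z) \<longleftrightarrow> triangle_on X Y Z"
proof
  assume "triangle_on X Y Z"
  then show "triangle_on (\<Sigma> X) (\<Sigma> Y) (\<Sigma> Z)"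
    unfolding triangle_on_def using rotate by blast
next
  have lift: "\<exists>a\<in>Hom T A B. Neg T (\<Sigma>a a) = b"
    if "b \<in> Hom T (\<Sigma> A) (\<Sigma> B)" "A \<in> Obj T" "B \<in> Obj T" for A B b
    using Sig_full[OF that(2,3) Neg_closed[OF that(1)]] Neg_Neg[OF that(1)] by metis
  assume "triangle_on (\<Sigma> X) (\<Sigma> Y) (\<Sigma> Z)"
  then obtain f g h where ex: "exact_at (\<Sigma> X) (\<Sigma> Y) (\<Sigma> Z) f g h" by (auto simp: triangle_on_def)
  then obtain f0 g0 h0 where lifts: "f0 \<in> Hom T X Y" "g0 \<in> Hom T Y Z" "h0 \<in> Hom T Z (\<Sigma> X)"
      "f = Neg T (\<Sigma>a f0)" "g = Neg T (\<Sigma>a g0)" "h = Neg T (\<Sigma>a h0)"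
    using lift objs Sig_Obj unfolding exact_at_def by metis
  have "exact_at X Y Z f0 g0 h0"
    using ex lifts rotate_iff Neg_closed[OF Sig_Hom] by metis
  then show "triangle_on X Y Z" by (auto simp: triangle_on_def)
qed

end

section \<open>Families of subcategories compatible with translation\<close>

context triangulated_category
begin

lemma Sig_pow_Obj: "X \<in> Obj T \<Longrightarrow> Sig_pow T n X \<in> Obj T"
proof -
  assume X: "X \<in> Obj T"
  have "(omap (Sig T) ^^ k) X \<in> Obj T" "(omap (Sig_inv T) ^^ k) X \<in> Obj T" for k
    by (induction k) (auto simp: X Sig_Obj Sig_inv_Obj)
  then show ?thesis by (simp add: Sig_pow_def)
qed

lemma Sig_pow_add_one:
  assumes X: "X \<in> Obj T"
  shows "isomorphic T (Sig_pow T (n + 1) X) (\<Sigma> (Sig_pow T n X))"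
proof (cases "n \<ge> 0")
  case True
  then have "nat (n + 1) = Suc (nat n)" by simp
  then have "Sig_pow T (n + 1) X = \<Sigma> (Sig_pow T n X)" using True by (simp add: Sig_pow_def)
  then show ?thesis using isomorphic_refl Sig_pow_Obj[OF X] by metis
next
  case False
  then have "nat (- n) = Suc (nat (- (n + 1)))" by simp
  then have "Sig_pow T n X = omap (Sig_inv T) (Sig_pow T (n + 1) X)"
    using False by (cases "n = - 1") (simp_all add: Sig_pow_def)
  then show ?thesis using Sig_Sig_inv[OF Sig_pow_Obj[OF X]] isomorphic_sym by simp
qed

lemma isomorphic_Sig_iff:
  assumes "X \<in> Obj T" "Y \<in> Obj T"
  shows "isomorphic T (\<Sigma> X) (\<Sigma> Y) \<longleftrightarrow> isomorphic T X Y"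
  using isomorphic_functor[OF sig_functor] isomorphic_functor[OF sig_inv_functor]
    Sig_inv_Sig[OF assms(1)] Sig_inv_Sig[OF assms(2)] isomorphic_sym isomorphic_trans by metis

text \<open>The condition that \<open>S n\<close> is the essential image \<open>\<Sigma>\<^sup>-\<^sup>n (S 0)\<close>, expressed one degree at a time so that it
  can be used without computing with iterated translations.\<close>

definition graded :: "(int \<Rightarrow> 'o set) \<Rightarrow> bool" where
  "graded S \<longleftrightarrow> (\<forall>n. iso_closed T (S n)) \<and> (\<forall>n. \<forall>X\<in>Obj T. \<Sigma> X \<in> S (n - 1) \<longleftrightarrow> X \<in> S n)"

lemma gradedD:
  assumes "graded S"
  shows graded_iso_closed: "\<lbrakk>isomorphic T X Y; X \<in> S n\<rbrakk> \<Longrightarrow> Y \<in> S n"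
    and graded_Obj: "X \<in> S n \<Longrightarrow> X \<in> Obj T"
    and graded_Sig: "X \<in> Obj T \<Longrightarrow> \<Sigma> X \<in> S (n - 1) \<longleftrightarrow> X \<in> S n"
  using assms isomorphic_Obj unfolding graded_def iso_closed_def by blast+

lemma graded_shift:
  assumes "iso_closed T S"
  shows "graded (\<lambda>n. shift T (- n) S)"
proof -
  have S: "A \<in> Obj T" if "A \<in> S" for A using assms that by (auto simp: iso_closed_def)
  have "iso_closed T (shift T n S)" for n
    using isomorphic_trans by (auto simp: iso_closed_def shift_def)
  moreover have "\<Sigma> X \<in> shift T (n + 1) S \<longleftrightarrow> X \<in> shift T n S" if X: "X \<in> Obj T" for n X
  proof -
    have "isomorphic T (Sig_pow T (n + 1) A) (\<Sigma> X) \<longleftrightarrow> isomorphic T (Sig_pow T n A) X"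
      if "A \<in> S" for A
      using isomorphic_Sig_iff[OF Sig_pow_Obj[OF S[OF that]] X] Sig_pow_add_one[OF S[OF that]]
        isomorphic_sym isomorphic_trans by metis
    then show ?thesis using X Sig_Obj by (auto simp: shift_def)
  qed
  from this[of _ "- n" for n] have "\<Sigma> X \<in> shift T (- (n - 1)) S \<longleftrightarrow> X \<in> shift T (- n) S"
    if "X \<in> Obj T" for n X using that by (simp add: algebra_simps)
  ultimately show ?thesis by (auto simp: graded_def)
qed

lemma shift_zero: "iso_closed T S \<Longrightarrow> shift T 0 S = S"
  using isomorphic_refl by (auto simp: iso_closed_def shift_def Sig_pow_def)

lemma ex_desuspension: "X \<in> Obj T \<Longrightarrow> \<exists>X'\<in>Obj T. isomorphic T (\<Sigma> X') X"
  using Sig_inv_Obj Sig_Sig_inv by blast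

text \<open>Statements about families graded by the integers propagate from one degree to all others in both
  directions, because every object is isomorphic to a translate. The equivalence in the hypothesis keeps
  the two directions of the induction together.\<close>

lemma int_shift_induct:
  fixes P :: "int \<Rightarrow> bool"
  assumes "P k" "\<And>n. P (n - 1) \<longleftrightarrow> P n"
  shows "P n"
  using assms(1)
proof (induction n rule: int_induct[where k = k])
  case (step1 i)
  then show ?case using assms(2)[of "i + 1"] by simp
qed (use assms(2) in auto)

lemma graded_subset:
  assumes S: "graded S" and S': "graded S'" and sub: "S a \<subseteq> S' b"
  shows "S (n + a) \<subseteq> S' (n + b)"
proof (induction n rule: int_shift_induct[where k = 0])
  fix n :: int
  have shift: "n - 1 + c = (n + c) - 1" for c by simp
  show "S (n - 1 + a) \<subseteq> S' (n - 1 + b) \<longleftrightarrow> S (n + a) \<subseteq> S' (n + b)"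
  proof
    assume "S (n - 1 + a) \<subseteq> S' (n - 1 + b)"
    then show "S (n + a) \<subseteq> S' (n + b)"
      using graded_Sig[OF S] graded_Sig[OF S'] graded_Obj[OF S] unfolding shift by blast
  next
    assume sub: "S (n + a) \<subseteq> S' (n + b)"
    show "S (n - 1 + a) \<subseteq> S' (n - 1 + b)"
    proof
      fix X assume X: "X \<in> S (n - 1 + a)"
      obtain X' where X': "X' \<in> Obj T" "isomorphic T (\<Sigma> X') X"
        using ex_desuspension graded_Obj[OF S X] by blast
      then have "\<Sigma> X' \<in> S (n - 1 + a)" using graded_iso_closed[OF S] X isomorphic_sym by blast
      then have "\<Sigma> X' \<in> S' (n - 1 + b)"
        using graded_Sig[OF S X'(1)] graded_Sig[OF S' X'(1)] sub unfolding shift by blast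
      then show "X \<in> S' (n - 1 + b)" using graded_iso_closed[OF S'] X'(2) by blast
    qed
  qed
qed (use sub in simp)

definition orthogonal :: "'o set \<Rightarrow> 'o set \<Rightarrow> bool" where
  "orthogonal A B \<longleftrightarrow> (\<forall>X\<in>A. \<forall>Y\<in>B. subsingleton_Hom X Y)"

lemma graded_orthogonal:
  assumes S: "graded S" and S': "graded S'" and orth: "orthogonal (S a) (S' b)"
  shows "orthogonal (S (n + a)) (S' (n + b))"
proof (induction n rule: int_shift_induct[where k = 0])
  fix n :: int
  have shift: "n - 1 + c = (n + c) - 1" for c by simp
  show "orthogonal (S (n - 1 + a)) (S' (n - 1 + b)) \<longleftrightarrow> orthogonal (S (n + a)) (S' (n + b))"
  proof
    assume orth: "orthogonal (S (n - 1 + a)) (S' (n - 1 + b))"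
    show "orthogonal (S (n + a)) (S' (n + b))"
      unfolding orthogonal_def
    proof (intro ballI)
      fix X Y assume X: "X \<in> S (n + a)" and Y: "Y \<in> S' (n + b)"
      have "\<Sigma> X \<in> S (n - 1 + a)" "\<Sigma> Y \<in> S' (n - 1 + b)"
        using graded_Sig[OF S graded_Obj[OF S X]] graded_Sig[OF S' graded_Obj[OF S' Y]] X Y
        unfolding shift by blast+
      then show "subsingleton_Hom X Y"
        using orth subsingleton_Hom_Sig graded_Obj[OF S X] graded_Obj[OF S' Y]
        unfolding orthogonal_def by blast
    qed
  next
    assume orth: "orthogonal (S (n + a)) (S' (n + b))"
    show "orthogonal (S (n - 1 + a)) (S' (n - 1 + b))"
      unfolding orthogonal_def
    proof (intro ballI)
      fix X Y assume X: "X \<in> S (n - 1 + a)" and Y: "Y \<in> S' (n - 1 + b)"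
      obtain X' where X': "X' \<in> Obj T" "isomorphic T (\<Sigma> X') X"
        using ex_desuspension graded_Obj[OF S X] by blast
      obtain Y' where Y': "Y' \<in> Obj T" "isomorphic T (\<Sigma> Y') Y"
        using ex_desuspension graded_Obj[OF S' Y] by blast
      have "\<Sigma> X' \<in> S (n - 1 + a)" using graded_iso_closed[OF S] X X'(2) isomorphic_sym by blast
      moreover have "\<Sigma> Y' \<in> S' (n - 1 + b)"
        using graded_iso_closed[OF S'] Y Y'(2) isomorphic_sym by blast
      ultimately have "subsingleton_Hom X' Y'"
        using graded_Sig[OF S X'(1)] graded_Sig[OF S' Y'(1)] orth unfolding shift orthogonal_def by blast
      then show "subsingleton_Hom X Y"
        using subsingleton_Hom_Sig X' Y' subsingleton_Hom_isomorphic by blast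
    qed
  qed
qed (use orth in simp)


section \<open>Truncation triangles\<close>

lemma t_le_graded: "t_structure T U \<Longrightarrow> graded (t_le T U)"
  and t_ge_graded: "t_structure T U \<Longrightarrow> graded (t_ge T U)"
  using graded_shift[of "fst U"] graded_shift[of "snd U"]
  by (simp_all add: t_structure_def t_le_def[abs_def] t_ge_def[abs_def])

lemma t_le_zero: "t_structure T U \<Longrightarrow> t_le T U 0 = fst U"
  and t_ge_zero: "t_structure T U \<Longrightarrow> t_ge T U 0 = snd U"
  using shift_zero by (simp_all add: t_structure_def t_le_def t_ge_def)

lemma int_mono_if_step:
  fixes S :: "int \<Rightarrow> 'b set"
  assumes "\<And>n. S n \<subseteq> S (n + 1)" "m \<le> n"
  shows "S m \<subseteq> S n"
  using assms(2) by (induction n rule: int_ge_induct) (use assms(1) in auto)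

lemma t_le_mono:
  assumes U: "t_structure T U" and "m \<le> n"
  shows "t_le T U m \<subseteq> t_le T U n"
proof (rule int_mono_if_step[OF _ assms(2)])
  fix n
  have "t_le T U (- 1) \<subseteq> t_le T U 0"
    using U t_le_zero[OF U] by (simp add: t_structure_def t_le_def)
  from graded_subset[OF t_le_graded[OF U] t_le_graded[OF U] this, of "n + 1"]
  show "t_le T U n \<subseteq> t_le T U (n + 1)" by simp
qed

lemma t_ge_antimono:
  assumes U: "t_structure T U" and "m \<le> n"
  shows "t_ge T U n \<subseteq> t_ge T U m"
proof -
  have "t_ge T U (- (- n)) \<subseteq> t_ge T U (- (- m))"
  proof (rule int_mono_if_step[where S = "\<lambda>n. t_ge T U (- n)"])
    fix n
    have "t_ge T U 1 \<subseteq> t_ge T U 0"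
      using U t_ge_zero[OF U] by (simp add: t_structure_def t_ge_def)
    from graded_subset[OF t_ge_graded[OF U] t_ge_graded[OF U] this, of "- n - 1"]
    show "t_ge T U (- n) \<subseteq> t_ge T U (- (n + 1))" by simp
  qed (use assms(2) in simp)
  then show ?thesis by simp
qed

lemma t_orthogonal:
  assumes U: "t_structure T U"
  shows "orthogonal (t_le T U n) (t_ge T U (n + 1))"
proof -
  have "orthogonal (t_le T U 0) (t_ge T U 1)"
    unfolding orthogonal_def
  proof (intro ballI)
    fix X Y assume X: "X \<in> t_le T U 0" and Y: "Y \<in> t_ge T U 1"
    have "Hom T X Y = {Zero T X Y}"
      using U X Y t_le_zero[OF U] by (simp add: t_structure_def t_ge_def)
    then show "subsingleton_Hom X Y"
      using subsingleton_Hom_iff graded_Obj[OF t_le_graded[OF U] X] graded_Obj[OF t_ge_graded[OF U] Y]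
      by blast
  qed
  from graded_orthogonal[OF t_le_graded[OF U] t_ge_graded[OF U] this, of n] show ?thesis by simp
qed

text \<open>The axiom provides truncation triangles in degree \<open>0\<close>. Those in degree \<open>n - 1\<close> are the translates of
  those in degree \<open>n\<close>, up to isomorphism of the three objects.\<close>

lemma t_triangle:
  assumes U: "t_structure T U"
  shows "\<forall>Z\<in>Obj T. \<exists>X\<in>t_le T U n. \<exists>Y\<in>t_ge T U (n + 1). triangle_on X Z Y"
proof (induction n rule: int_shift_induct[where k = 0])
  show "\<forall>Z\<in>Obj T. \<exists>X\<in>t_le T U 0. \<exists>Y\<in>t_ge T U (0 + 1). triangle_on X Z Y"
  proof
    fix Z assume "Z \<in> Obj T"
    then obtain X Y f g h where X: "X \<in> fst U" and Y: "Y \<in> snd U"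
      and tri: "f \<in> Hom T X Z" "g \<in> Hom T Z (omap (Sig_inv T) Y)"
        "h \<in> Hom T (omap (Sig_inv T) Y) (\<Sigma> X)" "(f, g, h) \<in> Exact T"
      using U unfolding t_structure_def by blast
    have YO: "omap (Sig_inv T) Y \<in> Obj T" using tri HomD by blast
    then have "omap (Sig_inv T) Y \<in> t_ge T U 1"
      using Y isomorphic_refl[OF YO] by (auto simp: t_ge_def shift_def Sig_pow_def)
    moreover have "triangle_on X Z (omap (Sig_inv T) Y)"
      using tri by (auto simp: triangle_on_def exact_at_def)
    ultimately show "\<exists>X\<in>t_le T U 0. \<exists>Y\<in>t_ge T U (0 + 1). triangle_on X Z Y"
      using X t_le_zero[OF U] by auto
  qed
next
  fix n :: int
  note le = graded_Sig[OF t_le_graded[OF U], of _ n] graded_iso_closed[OF t_le_graded[OF U]]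
    graded_Obj[OF t_le_graded[OF U]]
  note ge = graded_Sig[OF t_ge_graded[OF U], of _ "n + 1"] graded_iso_closed[OF t_ge_graded[OF U]]
    graded_Obj[OF t_ge_graded[OF U]]
  have shift: "n - 1 + 1 = (n + 1) - 1" by simp
  show "(\<forall>Z\<in>Obj T. \<exists>X\<in>t_le T U (n - 1). \<exists>Y\<in>t_ge T U (n - 1 + 1). triangle_on X Z Y) \<longleftrightarrow>
    (\<forall>Z\<in>Obj T. \<exists>X\<in>t_le T U n. \<exists>Y\<in>t_ge T U (n + 1). triangle_on X Z Y)" (is "?L \<longleftrightarrow> ?R")
  proof
    assume R: ?R
    show ?L
    proof
      fix Z assume "Z \<in> Obj T"
      then obtain Z' where Z': "Z' \<in> Obj T" "isomorphic T (\<Sigma> Z') Z" using ex_desuspension by blast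
      obtain X Y where XY: "X \<in> t_le T U n" "Y \<in> t_ge T U (n + 1)" "triangle_on X Z' Y"
        using R Z' by blast
      have "triangle_on (\<Sigma> X) (\<Sigma> Z') (\<Sigma> Y)" using triangle_on_Sig XY Z' le ge by metis
      then have "triangle_on (\<Sigma> X) Z (\<Sigma> Y)"
        using triangle_on_isomorphic[OF _ isomorphic_refl Z'(2) isomorphic_refl] Sig_Obj XY le(3) ge(3)
        by blast
      moreover have "\<Sigma> X \<in> t_le T U (n - 1)" "\<Sigma> Y \<in> t_ge T U (n + 1 - 1)"
        using XY le(1,3) ge(1,3) by blast+
      ultimately show "\<exists>X\<in>t_le T U (n - 1). \<exists>Y\<in>t_ge T U (n - 1 + 1). triangle_on X Z Y"
        unfolding shift by blast
    qed
  next
    assume L: ?L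
    show ?R
    proof
      fix Z assume Z: "Z \<in> Obj T"
      obtain X Y where XY: "X \<in> t_le T U (n - 1)" "Y \<in> t_ge T U (n + 1 - 1)" "triangle_on X (\<Sigma> Z) Y"
        using L Sig_Obj[OF Z] unfolding shift by blast
      obtain X' where X': "X' \<in> Obj T" "isomorphic T (\<Sigma> X') X" using ex_desuspension XY(1) le(3) by blast
      obtain Y' where Y': "Y' \<in> Obj T" "isomorphic T (\<Sigma> Y') Y" using ex_desuspension XY(2) ge(3) by blast
      have "triangle_on (\<Sigma> X') (\<Sigma> Z) (\<Sigma> Y')"
        using triangle_on_isomorphic[OF XY(3)] isomorphic_sym X' Y' isomorphic_refl Sig_Obj Z by blast
      then have "triangle_on X' Z Y'" using triangle_on_Sig X' Y' Z by blast
      moreover have "X' \<in> t_le T U n" using le(1,2) X' XY isomorphic_sym by blast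
      moreover have "Y' \<in> t_ge T U (n + 1)" using ge(1,2) Y' XY isomorphic_sym by blast
      ultimately show "\<exists>X\<in>t_le T U n. \<exists>Y\<in>t_ge T U (n + 1). triangle_on X Z Y" by blast
    qed
  qed
qed

lemma t_truncation:
  assumes U: "t_structure T U" and Z: "Z \<in> Obj T"
  obtains X Y f g h where "X \<in> t_le T U n" "Y \<in> t_ge T U (n + 1)" "exact_at X Z Y f g h"
    "\<Sigma> X \<in> t_le T U n"
proof -
  obtain X Y f g h where XY: "X \<in> t_le T U n" "Y \<in> t_ge T U (n + 1)" "exact_at X Z Y f g h"
    using t_triangle[OF U] Z unfolding triangle_on_def by blast
  then have "\<Sigma> X \<in> t_le T U (n - 1)"
    using graded_Sig[OF t_le_graded[OF U] graded_Obj[OF t_le_graded[OF U]]] by blast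
  then have "\<Sigma> X \<in> t_le T U n" using t_le_mono[OF U, of "n - 1" n] by auto
  with XY show thesis using that by blast
qed

text \<open>In the truncation triangle \<open>X \<rightarrow> Z \<rightarrow> Y\<close> the first map vanishes by orthogonality, so the identity of
  \<open>Z\<close> factors through \<open>g\<close>. The resulting retraction \<open>r\<close> is an inverse of \<open>g\<close>, because \<open>g\<close> is right
  cancellable for maps into \<open>Y\<close>. Hence \<open>Z\<close> is isomorphic to \<open>Y\<close>.\<close>

lemma t_ge_if_orthogonal:
  assumes U: "t_structure T U" and Z: "Z \<in> Obj T" and orth: "orthogonal (t_le T U n) {Z}"
  shows "Z \<in> t_ge T U (n + 1)"
proof -
  obtain X Y f g h where X: "X \<in> t_le T U n" and Y: "Y \<in> t_ge T U (n + 1)"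
    and ex: "exact_at X Z Y f g h" and SX: "\<Sigma> X \<in> t_le T U n"
    by (rule t_truncation[OF U Z])
  have f: "f \<in> Hom T X Z" and g: "g \<in> Hom T Z Y" using ex by (auto simp: exact_at_def)
  have objs: "X \<in> Obj T" "Y \<in> Obj T" using HomD f g by blast+
  have "f = Zero T X Z"
    using orth X f Zero_closed[OF objs(1) Z] unfolding orthogonal_def subsingleton_Hom_def by blast
  then have "Id T Z \<cdot> f = Zero T X Z" using id_left[OF f] by simp
  then obtain r where r: "r \<in> Hom T Y Z" "r \<cdot> g = Id T Z"
    using exact_factor_right[OF ex id_closed[OF Z]] by blast
  have "g \<cdot> r = Id T Y"
  proof (rule comp_right_inj[OF ex _ comp_closed[OF r(1) g] id_closed[OF objs(2)]])
    show "subsingleton_Hom (\<Sigma> X) Y" using t_orthogonal[OF U] SX Y by (auto simp: orthogonal_def)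
    show "(g \<cdot> r) \<cdot> g = Id T Y \<cdot> g"
      using comp_assoc[OF g r(1) g] r(2) id_left[OF g] id_right[OF g] by simp
  qed
  then have "isomorphic T Y Z" using r g unfolding isomorphic_iff by blast
  then show ?thesis using graded_iso_closed[OF t_ge_graded[OF U]] Y by blast
qed

text \<open>The first map of a truncation triangle is a coreflection: for \<open>B \<in> U\<^sub>\<le>\<^sub>n\<close> both \<open>Hom(B, Y)\<close> and
  \<open>Hom(\<Sigma> B, Y)\<close> vanish, which gives existence and uniqueness of factorizations.\<close>

lemma t_le_coreflective:
  assumes U: "t_structure T U"
  shows "coreflective T (t_le T U n)"
proof -
  have "\<exists>X e. coreflection_arr T (t_le T U n) Z X e" if Z: "Z \<in> Obj T" for Z
  proof -
    obtain X Y f g h where X: "X \<in> t_le T U n" and Y: "Y \<in> t_ge T U (n + 1)"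
      and ex: "exact_at X Z Y f g h"
      by (rule t_truncation[OF U Z])
    have f: "f \<in> Hom T X Z" and g: "g \<in> Hom T Z Y" using ex by (auto simp: exact_at_def)
    have "\<exists>!c. c \<in> Hom T B X \<and> f \<cdot> c = b" if B: "B \<in> t_le T U n" and b: "b \<in> Hom T B Z" for B b
    proof -
      have BY: "subsingleton_Hom B Y" using t_orthogonal[OF U] B Y by (auto simp: orthogonal_def)
      have "\<Sigma> B \<in> t_le T U (n - 1)" using graded_Sig[OF t_le_graded[OF U] HomD(1)[OF b]] B by blast
      then have "\<Sigma> B \<in> t_le T U n" using t_le_mono[OF U, of "n - 1" n] by auto
      then have SBY: "subsingleton_Hom (\<Sigma> B) Y"
        using t_orthogonal[OF U] Y by (auto simp: orthogonal_def)
      have "g \<cdot> b = Zero T B Y"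
        using BY comp_closed[OF b g] Zero_closed[OF HomD(1)[OF b] HomD(2)[OF g]]
        unfolding subsingleton_Hom_def by blast
      then obtain c where "c \<in> Hom T B X" "f \<cdot> c = b" using exact_factor_left[OF ex b] by blast
      then show ?thesis using comp_left_inj[OF ex SBY] by metis
    qed
    then have "coreflection_arr T (t_le T U n) Z X f"
      using X f by (simp add: coreflection_arr_def)
    then show ?thesis by blast
  qed
  then show ?thesis using graded_Obj[OF t_le_graded[OF U]] by (auto simp: coreflective_def)
qed

text \<open>Dually, for \<open>B \<in> U\<^sub>\<ge>\<^sub>n\<close> both \<open>Hom(X, B)\<close> and \<open>Hom(\<Sigma> X, B)\<close> vanish, where \<open>X \<in> U\<^sub>\<le>\<^sub>n\<^sub>-\<^sub>1\<close>.\<close>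

lemma t_ge_reflective:
  assumes U: "t_structure T U"
  shows "coreflective (op_cat T) (t_ge T U n)"
proof -
  have "\<exists>Y e. coreflection_arr (op_cat T) (t_ge T U n) Z Y e" if Z: "Z \<in> Obj T" for Z
  proof -
    obtain X Y f g h where X: "X \<in> t_le T U (n - 1)" and Y: "Y \<in> t_ge T U (n - 1 + 1)"
      and ex: "exact_at X Z Y f g h" and SX: "\<Sigma> X \<in> t_le T U (n - 1)"
      by (rule t_truncation[OF U Z])
    have f: "f \<in> Hom T X Z" and g: "g \<in> Hom T Z Y" using ex by (auto simp: exact_at_def)
    have orth: "subsingleton_Hom A B" if "A \<in> t_le T U (n - 1)" "B \<in> t_ge T U n" for A B
      using t_orthogonal[OF U, of "n - 1"] that by (auto simp: orthogonal_def)
    have "\<exists>!c. c \<in> Hom T Y B \<and> c \<cdot> g = b" if B: "B \<in> t_ge T U n" and b: "b \<in> Hom T Z B" for B b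
    proof -
      have "b \<cdot> f = Zero T X B"
        using orth[OF X B] comp_closed[OF f b] Zero_closed[OF HomD(1)[OF f] HomD(2)[OF b]]
        unfolding subsingleton_Hom_def by blast
      then obtain c where "c \<in> Hom T Y B" "c \<cdot> g = b" using exact_factor_right[OF ex b] by blast
      then show ?thesis using comp_right_inj[OF ex orth[OF SX B]] by metis
    qed
    then have "coreflection_arr (op_cat T) (t_ge T U n) Z Y g"
      using Y g by (simp add: coreflection_arr_def)
    then show ?thesis by blast
  qed
  then show ?thesis using graded_Obj[OF t_ge_graded[OF U]] by (auto simp: coreflective_def)
qed

section \<open>Regularity\<close>

lemma trunc_le_coreflection_arr:
  assumes U: "t_structure T U" and X: "X \<in> Obj T"
  shows "coreflection_arr T (t_le T U n) X (tau_le T U n X) (counit_le T U n X)"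
proof -
  have "\<exists>R\<epsilon>. case R\<epsilon> of (R, \<epsilon>) \<Rightarrow> \<exists>\<eta>. adjunction (full_sub T (t_le T U n)) T id_functor R \<eta> \<epsilon>"
    using coreflective_adjunction[OF t_le_coreflective[OF U]] by auto
  from someI_ex[OF this]
  have "\<exists>\<eta>. adjunction (full_sub T (t_le T U n)) T id_functor
      (fst (trunc_le T U n)) \<eta> (snd (trunc_le T U n))"
    by (simp add: trunc_le_def case_prod_unfold)
  moreover have "t_le T U n \<subseteq> Obj T" using graded_Obj[OF t_le_graded[OF U]] by blast
  ultimately show ?thesis
    using adjunction_coreflection_arr X by (auto simp: tau_le_def counit_le_def)
qed

lemma trunc_ge_reflection_arr:
  assumes U: "t_structure T U" and X: "X \<in> Obj T"
  shows "coreflection_arr (op_cat T) (t_ge T U n) X (tau_ge T U n X) (unit_ge T U n X)"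
proof -
  interpret op: category "op_cat T" by (rule category_op)
  have dual: "adjunction (full_sub (op_cat T) S) (op_cat T) id_functor L \<epsilon> \<eta> \<longleftrightarrow>
      adjunction T (full_sub T S) L id_functor \<eta> \<epsilon>" for S L \<eta> \<epsilon>
    unfolding op_cat_full_sub by (rule adjunction_op)
  have "\<exists>L\<eta>. case L\<eta> of (L, \<eta>) \<Rightarrow> \<exists>\<epsilon>. adjunction T (full_sub T (t_ge T U n)) L id_functor \<eta> \<epsilon>"
    using op.coreflective_adjunction[OF t_ge_reflective[OF U]] unfolding dual by auto
  from someI_ex[OF this]
  have "\<exists>\<epsilon>. adjunction T (full_sub T (t_ge T U n)) (fst (trunc_ge T U n)) id_functor
      (snd (trunc_ge T U n)) \<epsilon>"
    by (simp add: trunc_ge_def case_prod_unfold)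
  then obtain \<epsilon> where "adjunction (full_sub (op_cat T) (t_ge T U n)) (op_cat T) id_functor
      (fst (trunc_ge T U n)) \<epsilon> (snd (trunc_ge T U n))"
    unfolding dual by blast
  moreover have "t_ge T U n \<subseteq> Obj (op_cat T)" using graded_Obj[OF t_ge_graded[OF U]] by auto
  ultimately show ?thesis
    using op.adjunction_coreflection_arr[of "t_ge T U n"] X by (auto simp: tau_ge_def unit_ge_def)
qed

end

text \<open>The condition to which half of regularity reduces: the objects of \<open>P\<close> see enough of every object \<open>X\<close> to
  tell apart any two maps from \<open>X\<close> to an object of \<open>P\<close>.\<close>

definition separates_maps :: "('o, 'm, 'x) cat_scheme \<Rightarrow> 'o set \<Rightarrow> bool" where
  "separates_maps C P \<longleftrightarrow> (\<forall>X\<in>Obj C. \<forall>Y\<in>P. \<forall>f\<in>Hom C X Y. \<forall>f'\<in>Hom C X Y.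
     (\<forall>B\<in>P. \<forall>b\<in>Hom C B X. f \<cdot>\<^bsub>C\<^esub> b = f' \<cdot>\<^bsub>C\<^esub> b) \<longrightarrow> f = f')"

context triangulated_category
begin

text \<open>Reindexed by \<open>n \<mapsto> -n\<close>, the right halves form an increasing chain of coreflective subcategories of the
  opposite category, so both conditions are instances of one lemma.\<close>

lemma t_regular_iff:
  assumes U: "t_structure T U"
  shows "t_regular T U \<longleftrightarrow>
    separates_maps T (\<Union>n. t_le T U n) \<and> separates_maps (op_cat T) (\<Union>n. t_ge T U n)"
proof -
  interpret op: category "op_cat T" by (rule category_op)
  have le: "injective_map (\<lambda>f n. f \<cdot> counit_le T U n X) (Hom T X Y) (lim_le T U X Y) \<longleftrightarrow>
      (\<forall>f\<in>Hom T X Y. \<forall>f'\<in>Hom T X Y.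
        (\<forall>B\<in>(\<Union>n. t_le T U n). \<forall>b\<in>Hom T B X. f \<cdot> b = f' \<cdot> b) \<longrightarrow> f = f')" if "X \<in> Obj T" for X Y
    using injective_into_coreflection_limit_iff[OF that t_le_mono[OF U] trunc_le_coreflection_arr[OF U that]]
    unfolding lim_le_def trans_le_def .
  have union: "(\<Union>n. t_ge T U (- n)) = (\<Union>n. t_ge T U n)" 
  proof (intro equalityI subsetI)
    fix Y assume "Y \<in> (\<Union>n. t_ge T U n)"
    then obtain n where "Y \<in> t_ge T U (- (- n))" by auto
    then show "Y \<in> (\<Union>n. t_ge T U (- n))" by blast
  qed blast
  have ge: "injective_map (\<lambda>f n. unit_ge T U (- n) Y \<cdot> f) (Hom T X Y) (lim_ge T U X Y) \<longleftrightarrow>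
      (\<forall>f\<in>Hom T X Y. \<forall>f'\<in>Hom T X Y.
        (\<forall>B\<in>(\<Union>n. t_ge T U n). \<forall>b\<in>Hom T Y B. b \<cdot> f = b \<cdot> f') \<longrightarrow> f = f')" if Y: "Y \<in> Obj T" for X Y
    using op.injective_into_coreflection_limit_iff[of Y "\<lambda>n. t_ge T U (- n)"
        "\<lambda>n. tau_ge T U (- n) Y" "\<lambda>n. unit_ge T U (- n) Y" X]
      Y t_ge_antimono[OF U] trunc_ge_reflection_arr[OF U Y]
    unfolding lim_ge_def trans_ge_def union op_cat_simps by simp
  show ?thesis
    unfolding t_regular_def separates_maps_def op_cat_simps
    by (intro arg_cong2[where f = "(\<and>)"] ball_cong refl le ge)
qed

section \<open>t-structures at finite distance\<close>

text \<open>The one-sided comparison from which each part of the proposition is transferred. A common bound \<open>k\<close> for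
  both halves, with no offset between the two structures, makes the relation easy to use symmetrically.\<close>

definition near :: "nat \<Rightarrow> 'o set \<times> 'o set \<Rightarrow> 'o set \<times> 'o set \<Rightarrow> bool" where
  "near k U V \<longleftrightarrow> (\<forall>n. t_le T U n \<subseteq> t_le T V (n + int k) \<and> t_ge T U n \<subseteq> t_ge T V (n - int k))"

lemma t_ge_subset_if_t_le_subset:
  assumes U: "t_structure T U" and V: "t_structure T V" and sub: "t_le T U m \<subseteq> t_le T V n"
  shows "t_ge T V (n + 1) \<subseteq> t_ge T U (m + 1)"
proof
  fix Y assume Y: "Y \<in> t_ge T V (n + 1)"
  have "orthogonal (t_le T U m) {Y}" using t_orthogonal[OF V] Y sub by (auto simp: orthogonal_def)
  then show "Y \<in> t_ge T U (m + 1)"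
    using t_ge_if_orthogonal[OF U] graded_Obj[OF t_ge_graded[OF V] Y] by blast
qed

text \<open>The offset \<open>m\<close> in the definition of the distance is absorbed into the bound by monotonicity in the
  degree, at the price of a larger constant.\<close>

lemma near_if_finite_distance:
  assumes U: "t_structure T U" and V: "t_structure T V" and dist: "t_dist T U V < \<infinity>"
  obtains k where "near k U V" "near k V U"
proof -
  obtain m and d :: nat where m: "t_le T V m \<subseteq> t_le T U 0" and d: "t_le T U 0 \<subseteq> t_le T V (m + int d)"
  proof (cases "{d::nat. \<exists>m. t_le T V m \<subseteq> t_le T U 0 \<and> t_le T U 0 \<subseteq> t_le T V (m + int d)} = {}")
    case True
    then have "t_dist T U V = \<infinity>" unfolding t_dist_def True by (simp add: top_enat_def)
    then show ?thesis using dist by simp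
  next
    case False
    then show ?thesis using that by blast
  qed
  define k where "k = nat (\<bar>m\<bar> + int d)"
  have k: "- m \<le> int k" "m + int d \<le> int k" by (simp_all add: k_def)
  have VU: "t_le T V n \<subseteq> t_le T U (n + int k)" for n
  proof -
    have "t_le T V (n - m + m) \<subseteq> t_le T U (n - m + 0)"
      by (rule graded_subset[OF t_le_graded[OF V] t_le_graded[OF U] m])
    also have "\<dots> \<subseteq> t_le T U (n + int k)" by (rule t_le_mono[OF U]) (use k in simp)
    finally show ?thesis by simp
  qed
  have UV: "t_le T U n \<subseteq> t_le T V (n + int k)" for n
  proof -
    have "t_le T U (n + 0) \<subseteq> t_le T V (n + (m + int d))"
      by (rule graded_subset[OF t_le_graded[OF U] t_le_graded[OF V] d])
    also have "\<dots> \<subseteq> t_le T V (n + int k)" by (rule t_le_mono[OF V]) (use k in simp)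
    finally show ?thesis by simp
  qed
  have "t_ge T U n \<subseteq> t_ge T V (n - int k)" "t_ge T V n \<subseteq> t_ge T U (n - int k)" for n
    using t_ge_subset_if_t_le_subset[OF V U VU, of "n - int k - 1"]
      t_ge_subset_if_t_le_subset[OF U V UV, of "n - int k - 1"] by simp_all
  then have "near k U V" "near k V U" using VU UV by (simp_all add: near_def)
  then show thesis by (rule that)
qed

lemma near_Inter:
  assumes "near k U V"
  shows "(\<Inter>n. t_le T U n) \<subseteq> (\<Inter>n. t_le T V n)" "(\<Inter>n. t_ge T U n) \<subseteq> (\<Inter>n. t_ge T V n)"
proof -
  have "t_le T U (n - int k) \<subseteq> t_le T V (n - int k + int k)"
    "t_ge T U (n + int k) \<subseteq> t_ge T V (n + int k - int k)" for n
    using assms unfolding near_def by blast+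
  then show "(\<Inter>n. t_le T U n) \<subseteq> (\<Inter>n. t_le T V n)" "(\<Inter>n. t_ge T U n) \<subseteq> (\<Inter>n. t_ge T V n)"
    unfolding diff_add_cancel add_diff_cancel by blast+
qed

lemma near_Union:
  assumes "near k U V"
  shows "(\<Union>n. t_le T U n) \<subseteq> (\<Union>n. t_le T V n)" "(\<Union>n. t_ge T U n) \<subseteq> (\<Union>n. t_ge T V n)"
  using assms unfolding near_def by blast+

lemma near_bdd_objs:
  assumes V: "t_structure T V" and w: "near k U V"
  shows "t_bdd_objs T U \<subseteq> t_bdd_objs T V"
proof
  fix X assume "X \<in> t_bdd_objs T U"
  then obtain n :: nat where "X \<in> t_ge T U (- int n)" "X \<in> t_le T U (int n)"
    by (auto simp: t_bdd_objs_def t_interval_def)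
  then have "X \<in> t_ge T V (- int n - int k)" "X \<in> t_le T V (int n + int k)"
    using w by (auto simp: near_def)
  then have "X \<in> t_interval T V (- int (n + k)) (int (n + k))"
    by (simp add: t_interval_def)
  then show "X \<in> t_bdd_objs T V" unfolding t_bdd_objs_def by blast
qed

lemma gl_dim_finite_iff:
  assumes U: "t_structure T U"
  shows "gl_dim T U < \<infinity> \<longleftrightarrow> (\<exists>d::nat. orthogonal (t_ge T U 0) (t_le T U (- (int d + 1))))"
proof -
  let ?D = "{d::nat. \<forall>X \<in> t_ge T U 0. \<forall>Y \<in> t_le T U (- (int d + 1)). Hom T X Y = {Zero T X Y}}"
  have "?D = {d. orthogonal (t_ge T U 0) (t_le T U (- (int d + 1)))}"
    using subsingleton_Hom_iff graded_Obj[OF t_le_graded[OF U]] graded_Obj[OF t_ge_graded[OF U]]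
    unfolding orthogonal_def by blast
  moreover have "gl_dim T U < \<infinity> \<longleftrightarrow> ?D \<noteq> {}"
    unfolding gl_dim_def by (subst INF_less_iff) auto
  ultimately show ?thesis by blast
qed

text \<open>Both arguments of Hom move by at most \<open>k\<close>, so the bound grows by \<open>2k\<close>.\<close>

lemma near_gl_dim:
  assumes U: "t_structure T U" and V: "t_structure T V" and w: "near k V U" and fin: "gl_dim T U < \<infinity>"
  shows "gl_dim T V < \<infinity>"
proof -
  obtain d :: nat where "orthogonal (t_ge T U 0) (t_le T U (- (int d + 1)))"
    using fin gl_dim_finite_iff[OF U] by blast
  from graded_orthogonal[OF t_ge_graded[OF U] t_le_graded[OF U] this, of "- int k"]
  have "orthogonal (t_ge T U (0 - int k)) (t_le T U (- (int (d + 2 * k) + 1) + int k))" by (simp add: algebra_simps)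
  moreover have "t_ge T V 0 \<subseteq> t_ge T U (0 - int k)"
      "t_le T V (- (int (d + 2 * k) + 1)) \<subseteq> t_le T U (- (int (d + 2 * k) + 1) + int k)"
    using w unfolding near_def by blast+
  ultimately have "orthogonal (t_ge T V 0) (t_le T V (- (int (d + 2 * k) + 1)))"
    unfolding orthogonal_def by blast
  then show ?thesis using gl_dim_finite_iff[OF V] by blast
qed

text \<open>Stability makes all the \<open>U\<^sub>\<le>\<^sub>n\<close> equal, so the shift by \<open>k\<close> in the comparison is invisible. The right
  halves agree because they are orthogonal complements of the left ones.\<close>

lemma near_stable_eq:
  assumes U: "t_structure T U" and V: "t_structure T V" and w: "near k U V" "near k V U"
    and stable: "t_stable T U"
  shows "U = V"
proof -
  have "t_le T U 0 \<subseteq> t_le T U (- 1)"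
    using stable t_le_zero[OF U] by (simp add: t_stable_def t_le_def)
  then have step: "t_le T U (n + 0) \<subseteq> t_le T U (n + - 1)" for n
    by (rule graded_subset[OF t_le_graded[OF U] t_le_graded[OF U]])
  have anti: "t_le T U n \<subseteq> t_le T U m" if "m \<le> n" for m n
  proof -
    have "t_le T U (- (- n)) \<subseteq> t_le T U (- (- m))"
    proof (rule int_mono_if_step[where S = "\<lambda>n. t_le T U (- n)"])
      show "t_le T U (- j) \<subseteq> t_le T U (- (j + 1))" for j using step[of "- j"] by simp
    qed (use that in simp)
    then show ?thesis by simp
  qed
  have const: "t_le T U m = t_le T U n" if "m \<le> n" for m n
    using anti[OF that] t_le_mono[OF U that] by blast
  have "t_le T U (- int k) \<subseteq> t_le T V (- int k + int k)" "t_le T V 0 \<subseteq> t_le T U (0 + int k)"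
    using w unfolding near_def by blast+
  then have le: "t_le T U 0 = t_le T V 0"
    using const[of "- int k" 0] const[of 0 "int k"] by simp
  \<comment> \<open>Degree \<open>- 1\<close> is the one whose right orthogonal is the right half in degree \<open>0\<close>.\<close>
  have "t_le T U (- 1) = t_le T V (- 1)"
    using graded_subset[OF t_le_graded[OF U] t_le_graded[OF V], of 0 0 "- 1"]
      graded_subset[OF t_le_graded[OF V] t_le_graded[OF U], of 0 0 "- 1"] le by auto
  then have "t_ge T U 0 = t_ge T V 0"
    using t_ge_subset_if_t_le_subset[OF U V, of "- 1" "- 1"]
      t_ge_subset_if_t_le_subset[OF V U, of "- 1" "- 1"] by auto
  with le show ?thesis
    using t_le_zero t_ge_zero U V by (simp add: prod_eq_iff)
qed

end

theorem proposition4p7: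
  fixes T :: "('o, 'm) tri_cat" and U V :: "'o set \<times> 'o set"
  assumes "triangulated_category T"
    and "t_structure T U" and "t_structure T V"
    and "t_dist T U V < \<infinity>"
  shows
    "((\<Inter>n. t_le T U n) = (\<Inter>n. t_le T V n) \<and>
      (\<Inter>n. t_ge T U n) = (\<Inter>n. t_ge T V n) \<and>
      (nondegenerate T U \<longleftrightarrow> nondegenerate T V)) \<and>
     (t_bdd_objs T U = t_bdd_objs T V \<and> (t_bounded T U \<longleftrightarrow> t_bounded T V)) \<and>
     (t_regular T U \<longleftrightarrow> t_regular T V) \<and>
     (gl_dim T U < \<infinity> \<longleftrightarrow> gl_dim T V < \<infinity>) \<and>
     (t_stable T U \<or> t_stable T V \<longrightarrow> U = V)"
proof -
  interpret triangulated_category T by fact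
  obtain k where UV: "near k U V" and VU: "near k V U"
    using near_if_finite_distance[OF assms(2-4)] by blast
  have inter: "(\<Inter>n. t_le T U n) = (\<Inter>n. t_le T V n)" "(\<Inter>n. t_ge T U n) = (\<Inter>n. t_ge T V n)"
    using near_Inter[OF UV] near_Inter[OF VU]
    by (simp_all add: subset_antisym)
  have union: "(\<Union>n. t_le T U n) = (\<Union>n. t_le T V n)" "(\<Union>n. t_ge T U n) = (\<Union>n. t_ge T V n)"
    using near_Union[OF UV] near_Union[OF VU] by (simp_all add: subset_antisym)
  have "t_bdd_objs T U = t_bdd_objs T V"
    using near_bdd_objs[OF assms(3) UV] near_bdd_objs[OF assms(2) VU] by blast
  moreover have "nondegenerate T U \<longleftrightarrow> nondegenerate T V"
    unfolding nondegenerate_def inter ..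
  moreover have "t_bounded T U \<longleftrightarrow> t_bounded T V"
    unfolding t_bounded_def union ..
  moreover have "t_regular T U \<longleftrightarrow> t_regular T V"
    unfolding t_regular_iff[OF assms(2)] t_regular_iff[OF assms(3)] union ..
  moreover have "gl_dim T U < \<infinity> \<longleftrightarrow> gl_dim T V < \<infinity>"
    using near_gl_dim[OF assms(2,3) VU] near_gl_dim[OF assms(3,2) UV] by blast
  moreover have "t_stable T U \<or> t_stable T V \<longrightarrow> U = V"
    using near_stable_eq[OF assms(2,3) UV VU] near_stable_eq[OF assms(3,2) VU UV] by metis
  ultimately show ?thesis using inter by blast
qed

end
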